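(* Let $E$ be a nonautonomous attractor in $\mathbb{R}^d$ generated by $\{\Xi_k\}_{k\ge1}$, $\Xi_k=\{S_{k,1},\dots,S_{k,n_k}\}$, satisfying the gap separation condition. Let $\mu$ be a positive finite Borel measure on $\Sigma^\infty$, and let $\mu^\omega$ be its image measure under the projection $\Pi^\omega$. Assume that for each integer $k>0$ and all $i=1,2,\dots,n_k$, $$|S_{k,i}(x)-S_{k,i}(y)|\ge c_{k,i}|x-y|\qquad\text{for } x,y\in J,$$ where $c_{k,i}<1$, and that $c_*=\inf_{k,i}c_{k,i}>0$ and $c^*=\sup_{k,i}c_{k,i}<1$. Then for all $q>0$, $$\underline{D}_q(\mu^\omega)\ge d_q^-\quad\text{and}\quad \overline{D}_q(\mu^\omega)\ge d_q^+,$$ where $d_q^-$ and $d_q^+$ are the critical values defined (see context) with respect to the ratios $(c_{k,1},\dots,c_{k,n_k})_{k\ge1}$.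
   Context: **Words.** Let $\{n_k\}_{k\ge1}$ be integers $\ge2$; $\Sigma^k=\{u_1\cdots u_k:1\le u_j\le n_j\}$, $\Sigma^0=\{\emptyset\}$, $\Sigma^*=\bigcup_{k\ge0}\Sigma^k$, $\Sigma^\infty=\{u_1u_2\cdots:1\le u_k\le n_k\}$. For $\mathbf u=u_1\cdots u_k$ write $|\mathbf u|=k$ and $\mathbf u^-=u_1\cdots u_{k-1}$. $\mathcal C_{\mathbf u}\subset\Sigma^\infty$ is the cylinder of infinite words with prefix $\mathbf u$. **Nonautonomous attractor.** Let $J\subset\mathbb R^d$ be compact with non-empty interior and let $\Xi_k=\{S_{k,1},\dots,S_{k,n_k}\}$ be collections of contractive mappings. A collection $\{J_{\mathbf u}:\mathbf u\in\Sigma^*\}$ of closed subsets of $J$ fulfils the nonautonomous structure if: (1) $J_\emptyset=J$ and $J_{\mathbf u1},\dots,J_{\mathbf un_k}\subset J_{\mathbf u}$ for all $\mathbf u\in\Sigma^{k-1}$; (2) for each $\mathbf u=u_1\cdots u_k$, $J_{\mathbf u}=\Psi_{\mathbf u}(J)=\Psi_{u_1}\circ\cdots\circ\Psi_{u_k}(J)$, where $\Psi_{u_j}(x)=S_{j,u_j}x+\omega_{u_1\cdots u_j}$ for some $\omega_{u_1\cdots u_j}\in\mathbb R^d$; (3) $\lim_{k\to\infty}\max_{\mathbf u\in\Sigma^k}|J_{\mathbf u}|=0$, where $|\cdot|$ is diameter. The nonautonomous attractor is $E=\bigcap_{k\ge1}\bigcup_{\mathbf u\in\Sigma^k}J_{\mathbf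 u}$. The projection $\Pi^\omega:\Sigma^\infty\to E$ sends $\mathbf u=u_1u_2\cdots$ to the unique point of $\bigcap_{k}J_{u_1\cdots u_k}$, and $\mu^\omega(A)=\mu\{\mathbf u:\Pi^\omega(\mathbf u)\in A\}$. **Gap separation condition (GSC).** There is a constant $C>0$ such that for all $\mathbf u\in\Sigma^*$, $\inf\{|x-y|:x\in J_{\mathbf ui},\,y\in J_{\mathbf uj},\,i\ne j\}\ge C|J_{\mathbf u}|$. **Generalized $q$-dimensions.** Let $\mathcal M_r$ be the family of $r$-mesh cubes $[j_1r,(j_1+1)r)\times\cdots\times[j_dr,(j_d+1)r)$, $j_i\in\mathbb Z$. For a finite Borel measure $\nu$ on $\mathbb R^d$ and $q\ne1$, $\underline D_q(\nu)$ and $\overline D_q(\nu)$ are the $\liminf$ and $\limsup$ as $r\to0$ of $\frac{\log\sum_{Q\in\mathcal M_r}\nu(Q)^q}{(q-1)\log r}$; $\underline D_1(\nu)$ and $\overline D_1(\nu)$ are the $\liminf$ and $\limsup$ as $r\to0$ of $\frac{\sum_{Q\in\mathcal M_r}\nu(Q)\log\nu(Q)}{\log r}$. **Critical values.** Put $c_{\mathbf u}=c_{1,u_1}\cdots c_{k,u_k}$ ($c_\emptyset=1$), and for $s>0$, $0<r<1$, $\Sigma^*(s,r)=\{\mathbf u\in\Sigma^*:c_{\mathbf u}\le r<c_{\mathbf u^-}\}$. Let $F_q(s,r)=\sum_{\mathbf u\in\Sigma^*(s,r)}c_{\mathbf u}^{s(1-q)}\mu(\mathcal C_{\mathbf u})^q$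 for $q\ne1$ and $F_1(s,r)=\sum_{\mathbf u\in\Sigma^*(s,r)}\mu(\mathcal C_{\mathbf u})\log\big(c_{\mathbf u}^{-s}\mu(\mathcal C_{\mathbf u})\big)$. Then - for $q\ge1$: $d_q^-=\sup\{s:\limsup_{r\to0}F_q(s,r)<\infty\}$, $d_q^+=\sup\{s:\liminf_{r\to0}F_q(s,r)<\infty\}$; - for $0<q<1$: $d_q^-=\inf\{s:\liminf_{r\to0}F_q(s,r)<\infty\}$, $d_q^+=\inf\{s:\limsup_{r\to0}F_q(s,r)<\infty\}$. Here $s$ ranges over $s>0$, with $\sup\emptyset=0$, $\inf\emptyset=+\infty$, $0\log0=0$.
   Formalization: For q=1 the total mass of μ is assumed to be at least 1 (the claim fails for half the uniform measure on the Cantor set); the maps S_{k,i} are read as maps on J, so each Ψ_u is required to send J into J. *)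

theory Defs
  imports "HOL-Analysis.Analysis"
begin

text \<open>Levels are numbered from 1 on, as in the paper: \<open>n k\<close>, \<open>S k i\<close> and \<open>c k i\<close> matter only
  for \<open>k \<ge> 1\<close> and \<open>1 \<le> i \<le> n k\<close>.  The letter \<open>u\<^sub>j\<close> of a finite word \<open>u\<close> is \<open>u ! (j - 1)\<close>; the
  letter \<open>w\<^sub>j\<close> of an infinite word \<open>w\<close> is \<open>w j\<close>, with \<open>w\<close> extensional on \<open>{1..}\<close>.\<close>

definition words :: "(nat \<Rightarrow> nat) \<Rightarrow> nat \<Rightarrow> nat list set" where
  "words n k = {u. length u = k \<and> (\<forall>j<k. u ! j \<in> {1..n (Suc j)})}"

definition finite_words :: "(nat \<Rightarrow> nat) \<Rightarrow> nat list set" where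
  "finite_words n = (\<Union>k. words n k)"

definition infinite_words :: "(nat \<Rightarrow> nat) \<Rightarrow> (nat \<Rightarrow> nat) set" where
  "infinite_words n = (\<Pi>\<^sub>E k\<in>{1..}. {1..n k})"

definition prefix_of :: "(nat \<Rightarrow> nat) \<Rightarrow> nat \<Rightarrow> nat list" where
  "prefix_of w k = map w [1..<Suc k]"

definition cylinder :: "(nat \<Rightarrow> nat) \<Rightarrow> nat list \<Rightarrow> (nat \<Rightarrow> nat) set" where
  "cylinder n u = {w \<in> infinite_words n. prefix_of w (length u) = u}"

definition word_topology :: "(nat \<Rightarrow> nat) \<Rightarrow> (nat \<Rightarrow> nat) topology" where
  "word_topology n = product_topology (\<lambda>k. discrete_topology {1..n k}) {1..}"

definition word_borel :: "(nat \<Rightarrow> nat) \<Rightarrow> (nat \<Rightarrow> nat) measure" where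
  "word_borel n = sigma (infinite_words n) {U. openin (word_topology n) U}"


text \<open>For a nonempty word \<open>v = u\<^sub>1\<dots>u\<^sub>j\<close>, \<open>Psi S \<omega> v\<close> is the map \<open>x \<mapsto> S\<^bsub>j,u\<^sub>j\<^esub> x + \<omega>\<^bsub>u\<^sub>1\<dots>u\<^sub>j\<^esub>\<close>, which the
  paper abbreviates to \<open>\<Psi>\<^bsub>u\<^sub>j\<^esub>\<close> although its translation depends on the whole prefix.\<close>

definition Psi :: "(nat \<Rightarrow> nat \<Rightarrow> 'a \<Rightarrow> 'a) \<Rightarrow> (nat list \<Rightarrow> 'a) \<Rightarrow> nat list \<Rightarrow> 'a \<Rightarrow> 'a::real_vector" where
  "Psi S \<omega> v x = S (length v) (last v) x + \<omega> v"

definition Psi_comp :: "(nat \<Rightarrow> nat \<Rightarrow> 'a \<Rightarrow> 'a) \<Rightarrow> (nat list \<Rightarrow> 'a) \<Rightarrow> nat list \<Rightarrow> 'a \<Rightarrow> 'a::real_vector" where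
  "Psi_comp S \<omega> u = foldr (\<lambda>j f. Psi S \<omega> (take j u) \<circ> f) [1..<Suc (length u)] id"

text \<open>The \<open>S k i\<close> are contractions of \<open>J\<close> only; their values off \<open>J\<close> are irrelevant.  The conjunct
  \<open>Psi S \<omega> u ` J \<subseteq> J\<close> says precisely that the compositions in condition (2) are compositions
  of maps with domain \<open>J\<close>.\<close>

definition nonautonomous_structure ::
  "(nat \<Rightarrow> nat) \<Rightarrow> (nat \<Rightarrow> nat \<Rightarrow> 'a \<Rightarrow> 'a::euclidean_space) \<Rightarrow> (nat list \<Rightarrow> 'a) \<Rightarrow> 'a set \<Rightarrow> (nat list \<Rightarrow> 'a set)
    \<Rightarrow> bool" where
  "nonautonomous_structure n S \<omega> J Jf \<longleftrightarrow>
     (\<forall>k\<ge>1. n k \<ge> 2) \<and>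
     compact J \<and> interior J \<noteq> {} \<and>
     (\<forall>k\<ge>1. \<forall>i\<in>{1..n k}. \<exists>\<rho><1. \<rho>-lipschitz_on J (S k i)) \<and>
     (\<forall>u\<in>finite_words n. closed (Jf u) \<and> Jf u \<subseteq> J) \<and>
     \<comment> \<open>condition (1)\<close>
     Jf [] = J \<and>
     (\<forall>k\<ge>1. \<forall>u\<in>words n (k - 1). \<forall>i\<in>{1..n k}. Jf (u @ [i]) \<subseteq> Jf u) \<and>
     \<comment> \<open>condition (2)\<close>
     (\<forall>u\<in>finite_words n. u \<noteq> [] \<longrightarrow> Psi S \<omega> u ` J \<subseteq> J \<and> Jf u = Psi_comp S \<omega> u ` J) \<and>
     \<comment> \<open>condition (3)\<close>
     (\<lambda>k. MAX u\<in>words n k. diameter (Jf u)) \<longlonglongrightarrow> 0"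

definition nonautonomous_attractor :: "(nat \<Rightarrow> nat) \<Rightarrow> (nat list \<Rightarrow> 'a set) \<Rightarrow> 'a set" where
  "nonautonomous_attractor n Jf = (\<Inter>k\<in>{1..}. \<Union>u\<in>words n k. Jf u)"

definition projection :: "(nat list \<Rightarrow> 'a set) \<Rightarrow> (nat \<Rightarrow> nat) \<Rightarrow> 'a" where
  "projection Jf w = (THE x. x \<in> (\<Inter>k\<in>{1..}. Jf (prefix_of w k)))"

definition image_measure ::
  "(nat \<Rightarrow> nat) measure \<Rightarrow> (nat list \<Rightarrow> 'a set) \<Rightarrow> 'a::topological_space measure" where
  "image_measure \<mu> Jf = distr \<mu> borel (projection Jf)"

definition gap_separation_condition ::
  "(nat \<Rightarrow> nat) \<Rightarrow> (nat list \<Rightarrow> 'a::metric_space set) \<Rightarrow> bool" where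
  "gap_separation_condition n Jf \<longleftrightarrow>
     (\<exists>C>0. \<forall>u\<in>finite_words n.
        Inf {dist x y | x y i j. i \<in> {1..n (Suc (length u))} \<and> j \<in> {1..n (Suc (length u))} \<and>
               i \<noteq> j \<and> x \<in> Jf (u @ [i]) \<and> y \<in> Jf (u @ [j])}
          \<ge> C * diameter (Jf u))"


definition mesh_cube :: "real \<Rightarrow> int ^ 'd \<Rightarrow> (real ^ 'd) set" where
  "mesh_cube r j = {x. \<forall>i. of_int (j $ i) * r \<le> x $ i \<and> x $ i < (of_int (j $ i) + 1) * r}"

definition mesh :: "real \<Rightarrow> (real ^ 'd) set set" where
  "mesh r = range (mesh_cube r)"

text \<open>The sums below are meant for finite measures carried by a bounded set: then only finitely
  many mesh cubes have positive mass, and the remaining terms vanish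
  (\<open>0 powr q = 0\<close>, \<open>0 * ln 0 = 0\<close>).\<close>

definition dim_quotient :: "real \<Rightarrow> (real ^ 'd) measure \<Rightarrow> real \<Rightarrow> real" where
  "dim_quotient q \<nu> r =
     (if q = 1 then (\<Sum>\<^sub>\<infinity>Q\<in>mesh r. measure \<nu> Q * ln (measure \<nu> Q)) / ln r
      else ln (\<Sum>\<^sub>\<infinity>Q\<in>mesh r. measure \<nu> Q powr q) / ((q - 1) * ln r))"

definition lower_q_dim :: "real \<Rightarrow> (real ^ 'd) measure \<Rightarrow> ereal" where
  "lower_q_dim q \<nu> = Liminf (at_right 0) (\<lambda>r. ereal (dim_quotient q \<nu> r))"

definition upper_q_dim :: "real \<Rightarrow> (real ^ 'd) measure \<Rightarrow> ereal" where
  "upper_q_dim q \<nu> = Limsup (at_right 0) (\<lambda>r. ereal (dim_quotient q \<nu> r))"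


definition word_ratio :: "(nat \<Rightarrow> nat \<Rightarrow> real) \<Rightarrow> nat list \<Rightarrow> real" where
  "word_ratio c u = (\<Prod>j<length u. c (Suc j) (u ! j))"

text \<open>This is the paper's \<open>\<Sigma>\<^sup>*(s,r)\<close>, which does not depend on \<open>s\<close>.  It is finite as soon as the
  ratios are positive and bounded away from 1.\<close>

definition cut_set :: "(nat \<Rightarrow> nat) \<Rightarrow> (nat \<Rightarrow> nat \<Rightarrow> real) \<Rightarrow> real \<Rightarrow> nat list set" where
  "cut_set n c r = {u \<in> finite_words n. word_ratio c u \<le> r \<and> r < word_ratio c (butlast u)}"

definition F_sum :: "(nat \<Rightarrow> nat) \<Rightarrow> (nat \<Rightarrow> nat \<Rightarrow> real) \<Rightarrow> (nat \<Rightarrow> nat) measure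
    \<Rightarrow> real \<Rightarrow> real \<Rightarrow> real \<Rightarrow> real" where
  "F_sum n c \<mu> q s r =
     (if q = 1
      then (\<Sum>u\<in>cut_set n c r. measure \<mu> (cylinder n u) *
              ln (word_ratio c u powr (- s) * measure \<mu> (cylinder n u)))
      else (\<Sum>u\<in>cut_set n c r. word_ratio c u powr (s * (1 - q)) *
              measure \<mu> (cylinder n u) powr q))"

definition F_limsup :: "(nat \<Rightarrow> nat) \<Rightarrow> (nat \<Rightarrow> nat \<Rightarrow> real) \<Rightarrow> (nat \<Rightarrow> nat) measure
    \<Rightarrow> real \<Rightarrow> real \<Rightarrow> ereal" where
  "F_limsup n c \<mu> q s = Limsup (at_right 0) (\<lambda>r. ereal (F_sum n c \<mu> q s r))"

definition F_liminf :: "(nat \<Rightarrow> nat) \<Rightarrow> (nat \<Rightarrow> nat \<Rightarrow> real) \<Rightarrow> (nat \<Rightarrow> nat) measure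
    \<Rightarrow> real \<Rightarrow> real \<Rightarrow> ereal" where
  "F_liminf n c \<mu> q s = Liminf (at_right 0) (\<lambda>r. ereal (F_sum n c \<mu> q s r))"

text \<open>Inserting 0 implements the convention \<open>sup \<emptyset> = 0\<close> (in \<^typ>\<open>ereal\<close>, \<open>Sup {} = -\<infinity>\<close>) and is
  harmless otherwise, since \<open>s > 0\<close>.  The convention \<open>inf \<emptyset> = \<infinity>\<close> already holds in \<^typ>\<open>ereal\<close>.\<close>

definition d_minus :: "(nat \<Rightarrow> nat) \<Rightarrow> (nat \<Rightarrow> nat \<Rightarrow> real) \<Rightarrow> (nat \<Rightarrow> nat) measure \<Rightarrow> real \<Rightarrow> ereal"
  where
  "d_minus n c \<mu> q =
     (if q \<ge> 1 then Sup (insert 0 (ereal ` {s. s > 0 \<and> F_limsup n c \<mu> q s < \<infinity>}))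
      else Inf (ereal ` {s. s > 0 \<and> F_liminf n c \<mu> q s < \<infinity>}))"

definition d_plus :: "(nat \<Rightarrow> nat) \<Rightarrow> (nat \<Rightarrow> nat \<Rightarrow> real) \<Rightarrow> (nat \<Rightarrow> nat) measure \<Rightarrow> real \<Rightarrow> ereal"
  where
  "d_plus n c \<mu> q =
     (if q \<ge> 1 then Sup (insert 0 (ereal ` {s. s > 0 \<and> F_liminf n c \<mu> q s < \<infinity>}))
      else Inf (ereal ` {s. s > 0 \<and> F_limsup n c \<mu> q s < \<infinity>}))"

end

theory Submission
  imports Defs
begin

text \<open>
  The lower Lipschitz bounds give \<open>diameter (Jf u) \<ge> c\<^sub>u * diameter J\<close>, so by the gap separation
  condition the sets \<open>Jf u\<close> with \<open>u\<close> in the cut set at scale \<open>r\<close> are separated by a constant multiple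
  of \<open>r\<close>.  Hence every mesh cube of side \<open>r\<close> meets at most \<open>N\<close> of them, with \<open>N\<close> independent of \<open>r\<close>.
  Splitting \<open>\<mu>\<close> into the masses \<open>x u Q\<close> of cylinder \<open>u\<close> projected into cube \<open>Q\<close>, the matrix \<open>x\<close> has
  at most \<open>N\<close> nonzero entries for each \<open>Q\<close>; convexity then compares the power (or entropy) sums of
  its \<open>Q\<close>-marginal with those of its \<open>u\<close>-marginal up to constants.  Since \<open>c\<^sub>u \<le> r\<close> on the cut set,
  this translates boundedness of \<open>F\<^sub>q(s, r)\<close> into bounds on the dimension quotients.
\<close>

subsection \<open>Power and entropy sums\<close>

text \<open>Factor one power of \<open>f a\<close> off each term and bound the remaining
  \<open>f a powr (q - 1)\<close> by the same power of the total, which is monotone because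
  \<open>q - 1\<close> is nonnegative.\<close>

lemma sum_powr_le_powr_sum:
  fixes f :: "'a \<Rightarrow> real"
  assumes "finite A" "\<And>a. a \<in> A \<Longrightarrow> f a \<ge> 0" "q \<ge> 1"
  shows "(\<Sum>a\<in>A. f a powr q) \<le> (\<Sum>a\<in>A. f a) powr q"
proof -
  let ?X = "\<Sum>a\<in>A. f a"
  \<comment> \<open>Valid at \<open>x = 0\<close> too, since \<open>0 powr q = 0\<close> for every
    exponent.\<close>
  have split: "x powr q = x * x powr (q - 1)" if "x \<ge> 0" for x :: real
    using that by (cases "x = 0") (auto simp: powr_diff)
  have "f a powr q \<le> f a * ?X powr (q - 1)" if a: "a \<in> A" for a
  proof -
    have "f a \<le> ?X" using assms a by (intro member_le_sum) auto
    then show ?thesis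
      using assms a by (subst split) (auto intro!: mult_left_mono powr_mono2)
  qed
  then have "(\<Sum>a\<in>A. f a powr q) \<le> (\<Sum>a\<in>A. f a * ?X powr (q - 1))"
    by (rule sum_mono)
  also have "\<dots> = ?X powr q"
    using assms by (simp add: split sum_nonneg flip: sum_distrib_right)
  finally show ?thesis .
qed

text \<open>The same factorisation; now \<open>q - 1\<close> is nonpositive, so the comparison with
  the total reverses. That monotonicity needs a positive base, hence the separate treatment of zero
  terms.\<close>

lemma powr_sum_le_sum_powr:
  fixes f :: "'a \<Rightarrow> real"
  assumes "finite A" "\<And>a. a \<in> A \<Longrightarrow> f a \<ge> 0" "q \<le> 1"
  shows "(\<Sum>a\<in>A. f a) powr q \<le> (\<Sum>a\<in>A. f a powr q)"
proof -
  let ?X = "\<Sum>a\<in>A. f a"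
  have split: "x powr q = x * x powr (q - 1)" if "x \<ge> 0" for x :: real
    using that by (cases "x = 0") (auto simp: powr_diff)
  have "f a * ?X powr (q - 1) \<le> f a powr q" if a: "a \<in> A" for a
  proof (cases "f a = 0")
    case False
    have "f a \<le> ?X" using assms a by (intro member_le_sum) auto
    then show ?thesis
      using assms a False by (subst split) (auto intro!: mult_left_mono powr_mono2' simp: less_le)
  qed simp
  then have "(\<Sum>a\<in>A. f a * ?X powr (q - 1)) \<le> (\<Sum>a\<in>A. f a powr q)"
    by (rule sum_mono)
  moreover have "(\<Sum>a\<in>A. f a * ?X powr (q - 1)) = ?X powr q"
    using assms by (simp add: split sum_nonneg flip: sum_distrib_right)
  ultimately show ?thesis by simp
qed

text \<open>The total is at most \<open>N\<close> times the largest term, whose power occurs in the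
  sum on the right. This crude form replaces the convexity inequality with constant
  \<open>N powr (q - 1)\<close>.\<close>

lemma powr_sum_le_card_powr:
  fixes f :: "'a \<Rightarrow> real"
  assumes "finite A" "\<And>a. a \<in> A \<Longrightarrow> f a \<ge> 0" "card {a \<in> A. f a \<noteq> 0} \<le> N" "q > 0"
  shows "(\<Sum>a\<in>A. f a) powr q \<le> real N powr q * (\<Sum>a\<in>A. f a powr q)"
proof (cases "A = {}")
  case False
  define M where "M = Max (f ` A)"
  have "M \<in> f ` A" unfolding M_def using assms False by (intro Max_in) auto
  then obtain b where b: "b \<in> A" "M = f b" by auto
  have le: "f a \<le> M" if "a \<in> A" for a using assms that by (simp add: M_def)
  have "(\<Sum>a\<in>A. f a) = (\<Sum>a | a \<in> A \<and> f a \<noteq> 0. f a)"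
    using assms by (intro sum.mono_neutral_right) auto
  also have "\<dots> \<le> real (card {a \<in> A. f a \<noteq> 0}) * M"
    using le by (intro sum_bounded_above) auto
  also have "\<dots> \<le> real N * M"
    using assms b by (intro mult_right_mono) auto
  finally have "(\<Sum>a\<in>A. f a) powr q \<le> (real N * M) powr q"
    using assms by (intro powr_mono2 sum_nonneg) auto
  also have "\<dots> = real N powr q * f b powr q"
    using assms b by (simp add: powr_mult)
  also have "\<dots> \<le> real N powr q * (\<Sum>a\<in>A. f a powr q)"
    using assms b by (intro mult_left_mono member_le_sum) auto
  finally show ?thesis .
qed auto

lemma sum_powr_le_card_powr_sum:
  fixes f :: "'a \<Rightarrow> real"
  assumes "finite A" "\<And>a. a \<in> A \<Longrightarrow> f a \<ge> 0" "card {a \<in> A. f a \<noteq> 0} \<le> N" "q > 0"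
  shows "(\<Sum>a\<in>A. f a powr q) \<le> real N * (\<Sum>a\<in>A. f a) powr q"
proof -
  have "(\<Sum>a\<in>A. f a powr q) = (\<Sum>a | a \<in> A \<and> f a \<noteq> 0. f a powr q)"
    using assms by (intro sum.mono_neutral_right) auto
  also have "\<dots> \<le> real (card {a \<in> A. f a \<noteq> 0}) * (\<Sum>a\<in>A. f a) powr q"
    using assms by (intro sum_bounded_above powr_mono2 member_le_sum) auto
  also have "\<dots> \<le> real N * (\<Sum>a\<in>A. f a) powr q"
    using assms by (intro mult_right_mono) auto
  finally show ?thesis .
qed

lemma sum_mult_ln_le:
  fixes f :: "'a \<Rightarrow> real"
  assumes "finite A" "\<And>a. a \<in> A \<Longrightarrow> f a \<ge> 0"
  shows "(\<Sum>a\<in>A. f a * ln (f a)) \<le> (\<Sum>a\<in>A. f a) * ln (\<Sum>a\<in>A. f a)"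
proof -
  have "f a * ln (f a) \<le> f a * ln (\<Sum>a\<in>A. f a)" if a: "a \<in> A" for a
  proof (cases "f a = 0")
    case False
    then have "f a > 0" using assms(2)[OF a] by simp
    moreover have "f a \<le> (\<Sum>a\<in>A. f a)" using assms a by (intro member_le_sum) auto
    ultimately show ?thesis by (intro mult_left_mono) auto
  qed simp
  then show ?thesis by (simp add: sum_distrib_right sum_mono)
qed

text \<open>The entropy of at most \<open>N\<close> atoms is at most \<open>ln N\<close>, here for
  total mass \<open>?X\<close> instead of 1. The proof is Gibbs' inequality against the uniform
  weights \<open>?X / N\<close>, via \<open>ln t <= t - 1\<close> with
  \<open>t = ?X / (f a * N)\<close>.\<close>

lemma sum_entropy_le:
  fixes f :: "'a \<Rightarrow> real"
  assumes "finite A" "\<And>a. a \<in> A \<Longrightarrow> f a \<ge> 0" "card {a \<in> A. f a \<noteq> 0} \<le> N" "N > 0"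
  shows "(\<Sum>a\<in>A. f a) * ln (\<Sum>a\<in>A. f a) \<le> (\<Sum>a\<in>A. f a * ln (f a)) + (\<Sum>a\<in>A. f a) * ln (real N)"
proof -
  let ?X = "\<Sum>a\<in>A. f a" and ?P = "{a \<in> A. f a \<noteq> 0}"
  have X0: "?X \<ge> 0" using assms by (intro sum_nonneg) auto
  have restrict: "(\<Sum>a\<in>A. f a * g a) = (\<Sum>a\<in>?P. f a * g a)" for g
    using assms by (intro sum.mono_neutral_right) auto
  have X: "?X = (\<Sum>a\<in>?P. f a)"
    using restrict[of "\<lambda>_. 1"] by (simp only: mult_1_right)
  have step: "f a * ln ?X - f a * ln (f a) \<le> ?X / N - f a + f a * ln (real N)" if a: "a \<in> ?P" for a
  proof -
    have fa: "f a > 0" using assms(2)[of a] a by auto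
    have "f a \<le> ?X" using assms a by (intro member_le_sum) auto
    then have "?X > 0" using fa by linarith
    then have "ln (?X / (f a * N)) \<le> ?X / (f a * N) - 1"
      using fa assms by (intro ln_le_minus_one) auto
    also have "ln (?X / (f a * N)) = ln ?X - ln (f a) - ln (real N)"
      using fa assms \<open>?X > 0\<close> by (simp add: ln_div ln_mult)
    finally have "f a * (ln ?X - ln (f a) - ln (real N)) \<le> f a * (?X / (f a * N) - 1)"
      using fa by (intro mult_left_mono) auto
    then show ?thesis using fa by (simp add: algebra_simps)
  qed
  have "?X * ln ?X = (\<Sum>a\<in>?P. f a * ln ?X)"
    unfolding restrict[of "\<lambda>_. ln ?X", symmetric] by (simp only: sum_distrib_right)
  then have "?X * ln ?X - (\<Sum>a\<in>A. f a * ln (f a)) = (\<Sum>a\<in>?P. f a * ln ?X - f a * ln (f a))"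
    using restrict[of "\<lambda>a. ln (f a)"] by (simp only: sum_subtractf)
  also have "\<dots> \<le> (\<Sum>a\<in>?P. ?X / N - f a + f a * ln (real N))"
    by (intro sum_mono step)
  also have "\<dots> = card ?P * (?X / N) - ?X + ?X * ln (real N)"
    by (simp only: sum.distrib sum_subtractf sum_constant X[symmetric] sum_distrib_right[symmetric])
  \<comment> \<open>The support has at most \<open>N\<close> points, so the uniform weights add up
    to at most \<open>?X\<close> and cancel against \<open>- ?X\<close>.\<close>
  also have "\<dots> \<le> N * (?X / N) - ?X + ?X * ln (real N)"
    using assms X0 by (intro add_right_mono diff_right_mono mult_right_mono) auto
  also have "\<dots> = ?X * ln (real N)" using assms by simp
  finally show ?thesis by simp
qed

section \<open>Row sums and column sums of a nonnegative matrix with sparse columns\<close>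

context
  fixes x :: "'u \<Rightarrow> 'v \<Rightarrow> real" and U :: "'u set" and V :: "'v set" and N :: nat
  assumes finU: "finite U" and finV: "finite V"
    and x_nonneg: "\<And>u v. x u v \<ge> 0"
    and col_card: "\<And>v. v \<in> V \<Longrightarrow> card {u \<in> U. x u v \<noteq> 0} \<le> N"
begin

text \<open>Both sides are compared with the sum of the powers of single entries: sparsity controls
  the columns at the cost \<open>N powr q\<close>, and superadditivity controls the rows at no
  cost.\<close>

lemma column_powr_le_row_powr:
  assumes "q \<ge> 1"
  shows "(\<Sum>v\<in>V. (\<Sum>u\<in>U. x u v) powr q) \<le> real N powr q * (\<Sum>u\<in>U. (\<Sum>v\<in>V. x u v) powr q)"
proof -
  have "(\<Sum>v\<in>V. (\<Sum>u\<in>U. x u v) powr q) \<le> (\<Sum>v\<in>V. real N powr q * (\<Sum>u\<in>U. x u v powr q))"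
    using finU x_nonneg col_card assms by (intro sum_mono powr_sum_le_card_powr) auto
  also have "\<dots> = real N powr q * (\<Sum>u\<in>U. \<Sum>v\<in>V. x u v powr q)"
    by (subst sum.swap) (simp add: sum_distrib_left)
  also have "\<dots> \<le> real N powr q * (\<Sum>u\<in>U. (\<Sum>v\<in>V. x u v) powr q)"
    using finV x_nonneg assms by (intro mult_left_mono sum_mono sum_powr_le_powr_sum) auto
  finally show ?thesis .
qed

text \<open>Below exponent 1 powers are subadditive, so the route through single entries runs from
  rows to columns.\<close>

lemma row_powr_le_column_powr:
  assumes "0 < q" "q \<le> 1"
  shows "(\<Sum>u\<in>U. (\<Sum>v\<in>V. x u v) powr q) \<le> real N * (\<Sum>v\<in>V. (\<Sum>u\<in>U. x u v) powr q)"
proof -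
  have "(\<Sum>u\<in>U. (\<Sum>v\<in>V. x u v) powr q) \<le> (\<Sum>u\<in>U. \<Sum>v\<in>V. x u v powr q)"
    using finV x_nonneg assms by (intro sum_mono powr_sum_le_sum_powr) auto
  also have "\<dots> = (\<Sum>v\<in>V. \<Sum>u\<in>U. x u v powr q)"
    by (rule sum.swap)
  also have "\<dots> \<le> (\<Sum>v\<in>V. real N * (\<Sum>u\<in>U. x u v) powr q)"
    using finU x_nonneg col_card assms by (intro sum_mono sum_powr_le_card_powr_sum) auto
  finally show ?thesis by (simp add: sum_distrib_left)
qed

text \<open>Splitting a row into its entries can only lower the sum of \<open>t * ln t\<close>;
  merging the entries of a column raises it by at most \<open>ln N\<close> per unit of mass.\<close>

lemma column_entropy_le_row_entropy:
  assumes "N > 0"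
  shows "(\<Sum>v\<in>V. (\<Sum>u\<in>U. x u v) * ln (\<Sum>u\<in>U. x u v))
    \<le> (\<Sum>u\<in>U. (\<Sum>v\<in>V. x u v) * ln (\<Sum>v\<in>V. x u v)) + (\<Sum>u\<in>U. \<Sum>v\<in>V. x u v) * ln (real N)"
proof -
  have "(\<Sum>v\<in>V. (\<Sum>u\<in>U. x u v) * ln (\<Sum>u\<in>U. x u v))
     \<le> (\<Sum>v\<in>V. (\<Sum>u\<in>U. x u v * ln (x u v)) + (\<Sum>u\<in>U. x u v) * ln (real N))"
    using finU x_nonneg col_card assms by (intro sum_mono sum_entropy_le) auto
  also have "\<dots> = (\<Sum>u\<in>U. \<Sum>v\<in>V. x u v * ln (x u v)) + (\<Sum>v\<in>V. \<Sum>u\<in>U. x u v) * ln (real N)"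
    by (simp only: sum.distrib sum_distrib_right sum.swap[of _ U V])
  also have "(\<Sum>v\<in>V. \<Sum>u\<in>U. x u v) = (\<Sum>u\<in>U. \<Sum>v\<in>V. x u v)"
    by (rule sum.swap)
  also have "(\<Sum>u\<in>U. \<Sum>v\<in>V. x u v * ln (x u v)) \<le> (\<Sum>u\<in>U. (\<Sum>v\<in>V. x u v) * ln (\<Sum>v\<in>V. x u v))"
    using finV x_nonneg by (intro sum_mono sum_mult_ln_le) auto
  finally show ?thesis by simp
qed

end

subsection \<open>Lower and upper limits\<close>

lemma le_Liminf_of_eventually:
  fixes f g :: "'a \<Rightarrow> real"
  assumes "eventually (\<lambda>x. g x \<le> f x) F" "(g \<longlongrightarrow> s) F" "F \<noteq> bot"
  shows "ereal s \<le> Liminf F (\<lambda>x. ereal (f x))"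
proof -
  have "Liminf F (\<lambda>x. ereal (g x)) = ereal s"
    using assms by (intro lim_imp_Liminf) (auto simp: tendsto_ereal)
  moreover have "Liminf F (\<lambda>x. ereal (g x)) \<le> Liminf F (\<lambda>x. ereal (f x))"
    using assms(1) by (intro Liminf_mono) auto
  ultimately show ?thesis by simp
qed

lemma frequently_less_of_Liminf_less:
  fixes f :: "'a \<Rightarrow> 'b::complete_linorder"
  assumes "Liminf F f < y"
  shows "frequently (\<lambda>x. f x < y) F"
proof (rule ccontr)
  assume "\<not> ?thesis"
  then have "eventually (\<lambda>x. y \<le> f x) F" by (simp add: frequently_def not_less)
  from Liminf_bounded[OF this] show False using assms by simp
qed

lemma Liminf_le_of_frequently:
  fixes f :: "'a \<Rightarrow> 'b::complete_linorder"
  assumes "frequently (\<lambda>x. f x \<le> y) F"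
  shows "Liminf F f \<le> y"
proof (rule ccontr)
  assume "\<not> ?thesis"
  then have "eventually (\<lambda>x. \<not> f x \<le> y) F" using less_LiminfD[of y F f] by (simp add: not_le)
  then show False using assms by (simp add: frequently_def)
qed

text \<open>If the upper limit were below \<open>s\<close>, a real \<open>y\<close> between the two
  would eventually separate \<open>f x < y < g x\<close>.\<close>

lemma le_Limsup_of_frequently:
  fixes f g :: "'a \<Rightarrow> real"
  assumes "frequently (\<lambda>x. g x \<le> f x) F" "(g \<longlongrightarrow> s) F"
  shows "ereal s \<le> Limsup F (\<lambda>x. ereal (f x))"
proof (rule ccontr)
  assume "\<not> ?thesis"
  then obtain y where y: "Limsup F (\<lambda>x. ereal (f x)) < ereal y" "y < s"
    using ereal_dense2[of "Limsup F (\<lambda>x. ereal (f x))" "ereal s"] by (auto simp: not_le)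
  have "eventually (\<lambda>x. f x < y \<and> y < g x) F"
    using Limsup_lessD[OF y(1)] order_tendstoD(1)[OF assms(2) y(2)] by (simp add: eventually_conj_iff)
  then have "eventually (\<lambda>x. \<not> g x \<le> f x) F" by (rule eventually_mono) auto
  then show False using assms(1) by (simp add: frequently_def)
qed

lemma eventually_le_of_Limsup_less_PInf:
  fixes f :: "'a \<Rightarrow> real"
  assumes "Limsup F (\<lambda>x. ereal (f x)) < \<infinity>"
  obtains K where "K > 0" "eventually (\<lambda>x. f x \<le> K) F"
proof -
  obtain y where y: "Limsup F (\<lambda>x. ereal (f x)) < ereal y"
    using ereal_dense2[OF assms] by auto
  \<comment> \<open>The maximum with 1 makes the bound positive; \<open>dim_quotient_ge\<close>
    takes its logarithm.\<close>
  have "eventually (\<lambda>x. f x \<le> max y 1) F"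
    using Limsup_lessD[OF y] by (rule eventually_mono) auto
  then show ?thesis by (intro that[of "max y 1"]) auto
qed

lemma frequently_le_of_Liminf_less_PInf:
  fixes f :: "'a \<Rightarrow> real"
  assumes "Liminf F (\<lambda>x. ereal (f x)) < \<infinity>"
  obtains K where "K > 0" "frequently (\<lambda>x. f x \<le> K) F"
proof -
  obtain y where y: "Liminf F (\<lambda>x. ereal (f x)) < ereal y"
    using ereal_dense2[OF assms] by auto
  have "frequently (\<lambda>x. f x \<le> max y 1) F"
    using frequently_less_of_Liminf_less[OF y] by (rule frequently_elim1) auto
  then show ?thesis by (intro that[of "max y 1"]) auto
qed

text \<open>Constants independent of \<open>r\<close> enter the dimension quotients only through
  such a term \<open>B / ln r\<close>, which disappears in the limit.\<close>

lemma tendsto_add_divide_ln_at_right_0: "((\<lambda>r. s + B / ln r) \<longlongrightarrow> s) (at_right (0::real))"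
proof -
  have "((\<lambda>r. B / ln r) \<longlongrightarrow> 0) (at_right (0::real))"
    using ln_at_0 by (intro tendsto_divide_0[OF tendsto_const] filterlim_at_bot_imp_at_infinity)
  from tendsto_add[OF tendsto_const this, of s] show ?thesis by simp
qed

lemma eventually_at_right_0_less_1: "eventually (\<lambda>r::real. 0 < r \<and> r < 1) (at_right 0)"
  using eventually_at_right_real[of 0 "1::real"] by (auto elim: eventually_mono)

subsection \<open>Mesh cubes\<close>

text \<open>Turns membership in a cube into an equation between integer vectors, from which
  disjointness and covering both follow.\<close>

definition mesh_index :: "real \<Rightarrow> real ^ 'd \<Rightarrow> int ^ 'd" where
  "mesh_index r x = (\<chi> i. \<lfloor>x $ i / r\<rfloor>)"

lemma mem_mesh_cube_iff:
  assumes "r > 0"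
  shows "x \<in> mesh_cube r j \<longleftrightarrow> j = mesh_index r x"
proof -
  have "(of_int (j $ i) * r \<le> x $ i \<and> x $ i < (of_int (j $ i) + 1) * r) \<longleftrightarrow> j $ i = \<lfloor>x $ i / r\<rfloor>" for i
    using assms floor_eq_iff[of "x $ i / r" "j $ i"] by (auto simp: field_simps)
  then show ?thesis by (simp add: mesh_cube_def mesh_index_def vec_eq_iff)
qed

lemma disjoint_family_on_mesh:
  assumes "r > 0"
  shows "disjoint_family_on (\<lambda>Q. Q) (mesh r)"
  using assms by (auto simp: disjoint_family_on_def mesh_def mem_mesh_cube_iff)

lemma mesh_covers:
  assumes "r > 0"
  obtains Q where "Q \<in> mesh r" "x \<in> Q"
  using mem_mesh_cube_iff[OF assms, of x "mesh_index r x"] by (auto simp: mesh_def)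

lemma mesh_borel [measurable]:
  assumes "Q \<in> mesh r"
  shows "Q \<in> sets borel"
proof -
  obtain j where j: "Q = mesh_cube r j" using assms by (auto simp: mesh_def)
  have "Q = (\<Inter>i. {x. of_int (j $ i) * r \<le> x $ i} \<inter> {x. x $ i < (of_int (j $ i) + 1) * r})"
    by (auto simp: j mesh_cube_def)
  also have "\<dots> \<in> sets borel"
    by (intro sets.countable_INT' sets.Int borel_closed borel_open closed_Collect_le open_Collect_less
        continuous_intros) auto
  finally show ?thesis .
qed

lemma finite_vec_Pi:
  fixes A :: "'d::finite \<Rightarrow> 'a set"
  assumes "\<And>i. finite (A i)"
  shows "finite {x :: 'a ^ 'd. \<forall>i. x $ i \<in> A i}"
    and "card {x :: 'a ^ 'd. \<forall>i. x $ i \<in> A i} = (\<Prod>i\<in>UNIV. card (A i))"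
proof -
  have bij: "bij_betw vec_nth {x :: 'a ^ 'd. \<forall>i. x $ i \<in> A i} (PiE UNIV A)"
    by (rule bij_betw_byWitness[where f' = vec_lambda]) auto
  then show "finite {x :: 'a ^ 'd. \<forall>i. x $ i \<in> A i}"
    and "card {x :: 'a ^ 'd. \<forall>i. x $ i \<in> A i} = (\<Prod>i\<in>UNIV. card (A i))"
    using assms bij_betw_finite[OF bij] bij_betw_same_card[OF bij]
    by (simp_all add: finite_PiE card_PiE)
qed

lemma finite_mesh_meeting_bounded:
  fixes A :: "(real ^ 'd) set"
  assumes "bounded A" "r > 0"
  shows "finite {Q \<in> mesh r. Q \<inter> A \<noteq> {}}"
proof -
  obtain B where B: "\<And>x. x \<in> A \<Longrightarrow> norm x \<le> B" using assms(1) by (auto simp: bounded_iff)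
  have "\<lfloor>x $ i / r\<rfloor> \<in> {\<lfloor>(- B) / r\<rfloor>..\<lfloor>B / r\<rfloor>}" if "x \<in> A" for x i
    unfolding atLeastAtMost_iff
    using component_le_norm_cart[of x i] B[OF that] assms(2)
    by (intro conjI floor_mono divide_right_mono) auto
  then have "mesh_index r ` A \<subseteq> {j. \<forall>i. j $ i \<in> {\<lfloor>(- B) / r\<rfloor>..\<lfloor>B / r\<rfloor>}}"
    by (auto simp: mesh_index_def)
  then have "finite (mesh_index r ` A)"
    by (rule finite_subset) (rule finite_vec_Pi, simp)
  moreover have "{Q \<in> mesh r. Q \<inter> A \<noteq> {}} \<subseteq> mesh_cube r ` mesh_index r ` A"
    using assms(2) by (auto simp: mesh_def mem_mesh_cube_iff)
  ultimately show ?thesis using finite_surj by blast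
qed

text \<open>Pigeonhole principle for the subdivision of \<open>Q\<close> into \<open>m\<close> parts along each axis.\<close>
lemma card_separated_in_mesh_cube:
  fixes \<delta> :: real
  assumes "\<delta> > 0"
  shows "\<exists>N>0. \<forall>r Q U (p :: 'u \<Rightarrow> real ^ 'd). r > 0 \<longrightarrow> Q \<in> mesh r \<longrightarrow> p ` U \<subseteq> Q \<longrightarrow>
       pairwise (\<lambda>u v. dist (p u) (p v) \<ge> \<delta> * r) U \<longrightarrow> card U \<le> N"
proof -
  \<comment> \<open>With this \<open>m\<close>, two points in a common subcube of side
    \<open>r / m\<close> are closer than \<open>\<delta> * r\<close>, by the bound of the norm by
    the sum of the coordinates. So each of the \<open>m ^ CARD('d)\<close> subcubes receives at most
    one point.\<close>
  obtain m :: nat where m: "real CARD('d) / \<delta> < m" using reals_Archimedean2 by blast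
  have "real CARD('d) / \<delta> > 0" using assms by simp
  then have m0: "m > 0" using m by (cases m) auto
  show ?thesis
  proof (intro exI[of _ "m ^ CARD('d)"] conjI allI impI)
    fix r Q U and p :: "'u \<Rightarrow> real ^ 'd"
    assume r: "r > 0" and Q: "Q \<in> mesh r" and pQ: "p ` U \<subseteq> Q"
      and sep: "pairwise (\<lambda>u v. dist (p u) (p v) \<ge> \<delta> * r) U"
    obtain j where j: "Q = mesh_cube r j" using Q by (auto simp: mesh_def)
    let ?g = "\<lambda>u. mesh_index (r / m) (p u)"
    let ?T = "{k :: int ^ 'd. \<forall>i. k $ i \<in> {m * j $ i..<m * j $ i + m}}"
    have "inj_on ?g U"
    proof (rule inj_onI, rule ccontr)
      fix u v assume uv: "u \<in> U" "v \<in> U" "?g u = ?g v" "u \<noteq> v"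
      have "\<bar>p u $ i - p v $ i\<bar> \<le> r / m" for i
      proof -
        have "\<lfloor>p u $ i / (r / m)\<rfloor> = \<lfloor>p v $ i / (r / m)\<rfloor>"
          using uv(3) by (simp add: mesh_index_def vec_eq_iff)
        then have "\<bar>p u $ i / (r / m) - p v $ i / (r / m)\<bar> < 1" by linarith
        then show ?thesis using r m0 by (simp add: field_simps abs_le_iff abs_less_iff)
      qed
      then have "(\<Sum>i\<in>UNIV. \<bar>(p u - p v) $ i\<bar>) \<le> (\<Sum>i\<in>(UNIV::'d set). r / m)"
        by (intro sum_mono) auto
      then have "dist (p u) (p v) \<le> CARD('d) * (r / m)"
        using norm_le_l1_cart[of "p u - p v"] by (simp add: dist_norm)
      also have "\<dots> < \<delta> * r" using m m0 r assms by (simp add: field_simps)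
      finally show False using pairwiseD[OF sep uv(1,2,4)] by simp
    qed
    moreover have "?g ` U \<subseteq> ?T"
    proof clarify
      fix u i assume "u \<in> U"
      then have "of_int (j $ i) * r \<le> p u $ i" "p u $ i < (of_int (j $ i) + 1) * r"
        using pQ by (auto simp: j mesh_cube_def)
      then have "of_int (m * j $ i) \<le> p u $ i / (r / m)" "p u $ i / (r / m) < of_int (m * j $ i + m)"
        using r m0 mult_strict_left_mono[of "p u $ i" "(of_int (j $ i) + 1) * r" "real m"]
        by (auto simp: field_simps)
      then show "?g u $ i \<in> {m * j $ i..<m * j $ i + m}"
        by (auto simp: mesh_index_def le_floor_iff floor_less_iff)
    qed
    ultimately have "card U \<le> card ?T"
      by (intro card_inj_on_le finite_vec_Pi(1)) auto
    also have "\<dots> = m ^ CARD('d)"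
      by (subst finite_vec_Pi(2)) auto
    finally show "card U \<le> m ^ CARD('d)" .
  qed (use m0 in simp)
qed

subsection \<open>Words and cut sets\<close>

lemma finite_words_iff: "u \<in> finite_words n \<longleftrightarrow> (\<forall>j<length u. u ! j \<in> {1..n (Suc j)})"
  by (auto simp: finite_words_def words_def)

lemma words_iff: "u \<in> words n k \<longleftrightarrow> u \<in> finite_words n \<and> length u = k"
  by (auto simp: finite_words_iff words_def)

lemma Nil_in_finite_words [simp]: "[] \<in> finite_words n"
  by (simp add: finite_words_iff)

lemma finite_words_appendD: "u @ v \<in> finite_words n \<Longrightarrow> u \<in> finite_words n"
  by (auto simp: finite_words_iff nth_append split: if_splits)

lemma finite_words_snoc_iff [simp]:
  "u @ [i] \<in> finite_words n \<longleftrightarrow> u \<in> finite_words n \<and> i \<in> {1..n (Suc (length u))}"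
  by (auto simp: finite_words_iff nth_append less_Suc_eq)

lemma finite_words_of_length: "finite (words n k)"
proof (rule finite_subset)
  show "words n k \<subseteq> {u. set u \<subseteq> (\<Union>j<k. {1..n (Suc j)}) \<and> length u = k}"
    by (fastforce simp: words_def in_set_conv_nth)
qed (simp add: finite_lists_length_eq)

lemma prefix_of_Suc: "prefix_of w (Suc k) = prefix_of w k @ [w (Suc k)]"
  by (simp add: prefix_of_def)

lemma length_prefix_of [simp]: "length (prefix_of w k) = k"
  by (simp add: prefix_of_def)

lemma prefix_of_0 [simp]: "prefix_of w 0 = []"
  by (simp add: prefix_of_def)

lemma prefix_of_append:
  assumes "k \<le> l"
  obtains v where "prefix_of w l = prefix_of w k @ v"
proof -
  have "[1..<Suc l] = [1..<Suc k] @ [Suc k..<Suc l]"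
    using assms upt_add_eq_append[of 1 "Suc k" "l - k"] by simp
  then show ?thesis using that by (simp add: prefix_of_def)
qed

lemma prefix_of_in_finite_words [simp]:
  "w \<in> infinite_words n \<Longrightarrow> prefix_of w k \<in> finite_words n"
  by (induction k) (auto simp: prefix_of_Suc infinite_words_def PiE_def Pi_def)

lemma nth_prefix_of: "j < k \<Longrightarrow> prefix_of w k ! j = w (Suc j)"
  by (simp add: prefix_of_def del: upt_Suc)

lemma mem_cylinder_iff:
  "w \<in> cylinder n u \<longleftrightarrow> w \<in> infinite_words n \<and> (\<forall>j<length u. w (Suc j) = u ! j)"
  by (simp add: cylinder_def list_eq_iff_nth_eq nth_prefix_of)

lemma word_ratio_Nil [simp]: "word_ratio c [] = 1"
  by (simp add: word_ratio_def)

lemma word_ratio_snoc: "word_ratio c (u @ [i]) = word_ratio c u * c (Suc (length u)) i"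
  by (simp add: word_ratio_def nth_append)

lemma topspace_word_topology: "topspace (word_topology n) = infinite_words n"
  by (simp add: word_topology_def infinite_words_def)

lemma space_word_borel: "space (word_borel n) = infinite_words n"
  and sets_word_borel: "sets (word_borel n) = sigma_sets (infinite_words n) {U. openin (word_topology n) U}"
proof -
  have "{U. openin (word_topology n) U} \<subseteq> Pow (infinite_words n)"
    using openin_subset topspace_word_topology by blast
  then show "space (word_borel n) = infinite_words n"
    and "sets (word_borel n) = sigma_sets (infinite_words n) {U. openin (word_topology n) U}"
    by (simp_all add: word_borel_def)
qed

lemma cylinder_sets: "cylinder n u \<in> sets (word_borel n)"
proof -
  have open1: "openin (word_topology n) {w \<in> infinite_words n. w (Suc j) = a}" for j a
  proof -
    have "continuous_map (word_topology n) (discrete_topology {1..n (Suc j)}) (\<lambda>w. w (Suc j))"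
      unfolding word_topology_def by (rule continuous_map_product_projection) simp
    \<comment> \<open>The letter \<open>a\<close> may lie outside the alphabet; intersecting with
      the alphabet gives an open set of the discrete factor in every case.\<close>
    then have "openin (word_topology n)
        {w \<in> topspace (word_topology n). w (Suc j) \<in> {a} \<inter> {1..n (Suc j)}}"
      by (rule openin_continuous_map_preimage) simp
    moreover have "{w \<in> topspace (word_topology n). w (Suc j) \<in> {a} \<inter> {1..n (Suc j)}}
        = {w \<in> infinite_words n. w (Suc j) = a}"
      by (auto simp: topspace_word_topology infinite_words_def PiE_def Pi_def)
    ultimately show ?thesis by simp
  qed
  have "cylinder n u = infinite_words n \<inter> (\<Inter>j\<in>{..<length u}. {w \<in> infinite_words n. w (Suc j) = u ! j})"
    by (auto simp: mem_cylinder_iff)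
  also have "openin (word_topology n) \<dots>"
  \<comment> \<open>For the empty word the family of conditions is empty and the cylinder is the
    whole space; the rule for intersections of open sets asks for a nonempty family.\<close>
  proof (cases "length u = 0")
    case True
    then show ?thesis using openin_topspace[of "word_topology n"] by (simp add: topspace_word_topology)
  next
    case False
    then show ?thesis
      using open1 openin_topspace[of "word_topology n"]
      by (intro openin_Int openin_Inter) (auto simp: topspace_word_topology)
  qed
  finally show ?thesis by (auto simp: sets_word_borel)
qed

text \<open>There are only countably many finite words, and the preimage of each is a cylinder or
  empty.\<close>

lemma prefix_of_measurable: "(\<lambda>w. prefix_of w k) \<in> word_borel n \<rightarrow>\<^sub>M count_space UNIV"
proof (subst measurable_count_space_eq2_countable, safe)
  fix u
  have "(\<lambda>w. prefix_of w k) -` {u} \<inter> space (word_borel n)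
      = (if length u = k then cylinder n u else {})"
    by (auto simp: space_word_borel cylinder_def)
  then show "(\<lambda>w. prefix_of w k) -` {u} \<inter> space (word_borel n) \<in> sets (word_borel n)"
    by (simp add: cylinder_sets)
qed auto

section \<open>Ratios of words and the cut sets they define\<close>

locale ratio_system =
  fixes n :: "nat \<Rightarrow> nat" and c :: "nat \<Rightarrow> nat \<Rightarrow> real" and \<theta> :: real
  assumes c_pos: "\<And>k i. \<lbrakk>k \<ge> 1; i \<in> {1..n k}\<rbrakk> \<Longrightarrow> c k i > 0"
    and c_le: "\<And>k i. \<lbrakk>k \<ge> 1; i \<in> {1..n k}\<rbrakk> \<Longrightarrow> c k i \<le> \<theta>"
    and \<theta>: "0 < \<theta>" "\<theta> < 1"
begin

lemma word_ratio_pos: "u \<in> finite_words n \<Longrightarrow> word_ratio c u > 0"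
  using c_pos by (auto simp: word_ratio_def finite_words_iff intro!: prod_pos)

lemma word_ratio_append_le: "u @ v \<in> finite_words n \<Longrightarrow> word_ratio c (u @ v) \<le> word_ratio c u"
proof (induction v rule: rev_induct)
  case (snoc i v)
  then have uv: "u @ v \<in> finite_words n" and i: "i \<in> {1..n (Suc (length (u @ v)))}"
    by (simp_all flip: append_assoc)
  have "word_ratio c ((u @ v) @ [i]) \<le> word_ratio c (u @ v) * 1"
    unfolding word_ratio_snoc
    using word_ratio_pos[OF uv] c_le[OF _ i] \<theta> by (intro mult_left_mono) auto
  then show ?case using snoc.IH[OF uv] by simp
qed simp

lemma word_ratio_le_power: "u \<in> finite_words n \<Longrightarrow> word_ratio c u \<le> \<theta> ^ length u"
proof (induction u rule: rev_induct)
  case (snoc i u)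
  then show ?case
    using c_le[of "Suc (length u)" i] c_pos[of "Suc (length u)" i] \<theta>
      mult_mono[of "word_ratio c u" "\<theta> ^ length u" "c (Suc (length u)) i" \<theta>]
    by (simp add: word_ratio_snoc mult.commute)
qed simp

lemma cut_setD:
  assumes "u \<in> cut_set n c r"
  shows "u \<in> finite_words n" "0 < word_ratio c u" "word_ratio c u \<le> r" "r < word_ratio c (butlast u)"
  using assms word_ratio_pos by (auto simp: cut_set_def)

text \<open>The ratio of \<open>butlast u\<close> still exceeds \<open>r\<close>, while ratios decay
  geometrically in the length; this bounds the length of \<open>u\<close>.\<close>

lemma finite_cut_set:
  assumes "r > 0"
  shows "finite (cut_set n c r)"
proof -
  obtain K where K: "\<theta> ^ K < r" using real_arch_pow_inv[OF assms \<theta>(2)] by blast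
  have "length u \<le> K" if u: "u \<in> cut_set n c r" for u
  proof (rule ccontr)
    assume len: "\<not> length u \<le> K"
    have "butlast u \<in> finite_words n"
      using cut_setD(1)[OF u] len finite_words_appendD[of "butlast u" "[last u]"]
      by (cases "u = []") auto
    then have "word_ratio c (butlast u) \<le> \<theta> ^ length (butlast u)" by (rule word_ratio_le_power)
    also have "\<dots> \<le> \<theta> ^ K" using len \<theta> by (intro power_decreasing) auto
    finally show False using cut_setD(4)[OF u] K by simp
  qed
  then have "cut_set n c r \<subseteq> (\<Union>k\<le>K. words n k)"
    using cut_setD(1) by (auto simp: words_iff)
  then show ?thesis by (rule finite_subset) (simp add: finite_words_of_length)
qed

text \<open>If \<open>v\<close> were nonempty, \<open>butlast (u @ v)\<close> would extend
  \<open>u\<close> and so have ratio at most that of \<open>u\<close>, hence at most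
  \<open>r\<close>.\<close>

lemma cut_set_antichain:
  assumes "u \<in> cut_set n c r" "u @ v \<in> cut_set n c r"
  shows "v = []"
proof (rule ccontr)
  assume "v \<noteq> []"
  then have "butlast (u @ v) = u @ butlast v" "(u @ butlast v) @ [last v] = u @ v"
    by (simp_all add: butlast_append)
  then have "word_ratio c (butlast (u @ v)) \<le> word_ratio c u"
    using word_ratio_append_le[of u "butlast v"] cut_setD(1)[OF assms(2)]
      finite_words_appendD[of "u @ butlast v" "[last v]" n] by simp
  then show False using cut_setD(3)[OF assms(1)] cut_setD(4)[OF assms(2)] by simp
qed

text \<open>The cut set acts as a stopping time: take the first level at which the ratio has dropped
  to \<open>r\<close> or below.\<close>

lemma cut_set_prefix_exists:
  assumes "w \<in> infinite_words n" "0 < r" "r < 1"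
  obtains k where "prefix_of w k \<in> cut_set n c r"
proof -
  let ?P = "\<lambda>k. word_ratio c (prefix_of w k) \<le> r"
  obtain K where K: "\<theta> ^ K < r" using real_arch_pow_inv[OF assms(2) \<theta>(2)] by blast
  then have "?P K" using word_ratio_le_power[of "prefix_of w K"] assms by simp
  define k where "k = (LEAST k. ?P k)"
  have Pk: "?P k" unfolding k_def by (rule LeastI) (rule \<open>?P K\<close>)
  \<comment> \<open>The empty word has ratio 1, so \<open>r < 1\<close> rules out level 0 and a
    previous level exists.\<close>
  then obtain l where l: "k = Suc l" using assms by (cases k) auto
  then have "\<not> ?P l" unfolding k_def using not_less_Least by (metis lessI)
  then have "prefix_of w k \<in> cut_set n c r"
    using Pk assms by (auto simp: cut_set_def l prefix_of_Suc infinite_words_def PiE_def Pi_def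
        intro: prefix_of_in_finite_words[unfolded infinite_words_def PiE_def Pi_def])
  then show ?thesis by (rule that)
qed

text \<open>Two prefixes of one infinite word are comparable, and comparable members of the cut set
  coincide.\<close>

lemma disjoint_cylinders: "disjoint_family_on (cylinder n) (cut_set n c r)"
proof -
  have "u = v" if "u \<in> cut_set n c r" "v \<in> cut_set n c r" "length u \<le> length v"
    "w \<in> cylinder n u" "w \<in> cylinder n v" for u v w
  proof -
    obtain z where "prefix_of w (length v) = prefix_of w (length u) @ z"
      using prefix_of_append \<open>length u \<le> length v\<close> by blast
    then have "v = u @ z" using that by (simp add: cylinder_def)
    then show ?thesis using cut_set_antichain that by auto
  qed
  then show ?thesis
    by (auto simp: disjoint_family_on_def) (metis nat_le_linear)
qed

lemma UN_cylinder_cut_set: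
  assumes "0 < r" "r < 1"
  shows "(\<Union>u\<in>cut_set n c r. cylinder n u) = infinite_words n"
proof
  show "infinite_words n \<subseteq> (\<Union>u\<in>cut_set n c r. cylinder n u)"
  proof
    fix w assume w: "w \<in> infinite_words n"
    obtain k where "prefix_of w k \<in> cut_set n c r" using cut_set_prefix_exists[OF w assms] .
    moreover have "w \<in> cylinder n (prefix_of w k)" using w by (simp add: cylinder_def)
    ultimately show "w \<in> (\<Union>u\<in>cut_set n c r. cylinder n u)" by blast
  qed
qed (auto simp: cylinder_def)

end

text \<open>Peels off the innermost map, as induction on words extended to the right requires. The
  outer maps see only prefixes of \<open>u\<close>, so their translations are unchanged.\<close>

lemma Psi_comp_snoc:
  fixes S :: "nat \<Rightarrow> nat \<Rightarrow> 'a \<Rightarrow> 'a::real_vector"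
  shows "Psi_comp S \<omega> (u @ [i]) x = Psi_comp S \<omega> u (Psi S \<omega> (u @ [i]) x)"
proof -
  have foldr_comp: "foldr (\<lambda>j f. Psi S \<omega> (g j) \<circ> f) js h x = foldr (\<lambda>j f. Psi S \<omega> (g j) \<circ> f) js id (h x)"
    for g h js x by (induction js) auto
  have "foldr (\<lambda>j f. Psi S \<omega> (take j (u @ [i])) \<circ> f) [1..<Suc (length u)] h
     = foldr (\<lambda>j f. Psi S \<omega> (take j u) \<circ> f) [1..<Suc (length u)] h" for h :: "'a \<Rightarrow> 'a"
    by (rule foldr_cong) auto
  moreover have "[1..<Suc (length (u @ [i]))] = [1..<Suc (length u)] @ [Suc (length u)]"
    by simp
  ultimately have "Psi_comp S \<omega> (u @ [i]) x
      = foldr (\<lambda>j f. Psi S \<omega> (take j u) \<circ> f) [1..<Suc (length u)] (Psi S \<omega> (u @ [i])) x"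
    unfolding Psi_comp_def by (simp del: upt_Suc)
  also have "\<dots> = Psi_comp S \<omega> u (Psi S \<omega> (u @ [i]) x)"
    unfolding Psi_comp_def by (rule foldr_comp)
  finally show ?thesis .
qed

subsection \<open>The attractor and its projection\<close>

locale gap_separated_system = ratio_system n c \<theta> + finite_measure \<mu>
  for n :: "nat \<Rightarrow> nat" and c :: "nat \<Rightarrow> nat \<Rightarrow> real" and \<theta> :: real and \<mu> :: "(nat \<Rightarrow> nat) measure" +
  fixes S :: "nat \<Rightarrow> nat \<Rightarrow> real ^ 'd \<Rightarrow> real ^ 'd"
    and \<omega> :: "nat list \<Rightarrow> real ^ 'd"
    and J :: "(real ^ 'd) set"
    and Jf :: "nat list \<Rightarrow> (real ^ 'd) set"
  assumes nonautonomous: "nonautonomous_structure n S \<omega> J Jf"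
    and gap: "gap_separation_condition n Jf"
    and sets_\<mu>: "sets \<mu> = sets (word_borel n)"
    and expansion: "\<And>k i x y. \<lbrakk>k \<ge> 1; i \<in> {1..n k}; x \<in> J; y \<in> J\<rbrakk>
           \<Longrightarrow> norm (S k i x - S k i y) \<ge> c k i * norm (x - y)"
begin

lemma compact_J: "compact J" and interior_J: "interior J \<noteq> {}" and Jf_Nil: "Jf [] = J"
  and diameter_tendsto: "(\<lambda>k. MAX u\<in>words n k. diameter (Jf u)) \<longlonglongrightarrow> 0"
  using nonautonomous by (auto simp: nonautonomous_structure_def)

lemma Jf_subset_J: "u \<in> finite_words n \<Longrightarrow> Jf u \<subseteq> J"
  using nonautonomous by (auto simp: nonautonomous_structure_def)

lemma compact_Jf: "u \<in> finite_words n \<Longrightarrow> compact (Jf u)"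
  using nonautonomous compact_Int_closed[OF compact_J, of "Jf u"] Jf_subset_J[of u]
  by (simp add: nonautonomous_structure_def Int_absorb1)

lemma Psi_in_J: "\<lbrakk>u \<in> finite_words n; u \<noteq> []; x \<in> J\<rbrakk> \<Longrightarrow> Psi S \<omega> u x \<in> J"
  using nonautonomous unfolding nonautonomous_structure_def by blast

lemma Jf_eq_image: "u \<in> finite_words n \<Longrightarrow> Jf u = Psi_comp S \<omega> u ` J"
  using nonautonomous Jf_Nil by (cases "u = []") (auto simp: nonautonomous_structure_def Psi_comp_def)

lemma Jf_nonempty: "u \<in> finite_words n \<Longrightarrow> Jf u \<noteq> {}"
  using Jf_eq_image interior_J interior_subset by fastforce

lemma Jf_append_subset: "u @ v \<in> finite_words n \<Longrightarrow> Jf (u @ v) \<subseteq> Jf u"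
proof (induction v rule: rev_induct)
  case (snoc i v)
  then have uv: "u @ v \<in> finite_words n" and i: "i \<in> {1..n (Suc (length (u @ v)))}"
    by (simp_all flip: append_assoc)
  have "Jf ((u @ v) @ [i]) \<subseteq> Jf (u @ v)"
    using nonautonomous uv i unfolding nonautonomous_structure_def
    by (metis One_nat_def diff_Suc_1 le_add1 plus_1_eq_Suc words_iff)
  then show ?case using snoc.IH[OF uv] by simp
qed simp

text \<open>The lower Lipschitz bounds multiply along the composition: translations cancel in
  differences, and \<open>Psi_in_J\<close> keeps the intermediate points in \<open>J\<close>, where
  the bounds hold.\<close>

lemma Psi_comp_expansion:
  "\<lbrakk>u \<in> finite_words n; x \<in> J; y \<in> J\<rbrakk>
    \<Longrightarrow> dist (Psi_comp S \<omega> u x) (Psi_comp S \<omega> u y) \<ge> word_ratio c u * dist x y"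
proof (induction u arbitrary: x y rule: rev_induct)
  case Nil
  then show ?case by (simp add: Psi_comp_def)
next
  case (snoc i u)
  let ?\<Psi> = "Psi S \<omega> (u @ [i])"
  have u: "u \<in> finite_words n" and i: "i \<in> {1..n (Suc (length u))}" using snoc.prems by auto
  have "word_ratio c u * (c (Suc (length u)) i * dist x y) \<le> word_ratio c u * dist (?\<Psi> x) (?\<Psi> y)"
    using expansion[OF _ i snoc.prems(2,3)] word_ratio_pos[OF u]
    by (intro mult_left_mono) (auto simp: Psi_def dist_norm)
  also have "\<dots> \<le> dist (Psi_comp S \<omega> u (?\<Psi> x)) (Psi_comp S \<omega> u (?\<Psi> y))"
    using snoc.prems by (intro snoc.IH u Psi_in_J) auto
  finally show ?case by (simp add: word_ratio_snoc Psi_comp_snoc mult.assoc)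
qed

text \<open>By compactness some pair of points realises the diameter of \<open>J\<close>; its image
  under the expanding composition lies in \<open>Jf u\<close>.\<close>

lemma diameter_Jf_ge:
  assumes u: "u \<in> finite_words n"
  shows "diameter (Jf u) \<ge> word_ratio c u * diameter J"
proof -
  have "J \<noteq> {}" using interior_J interior_subset by auto
  then obtain x y where xy: "x \<in> J" "y \<in> J" "dist x y = diameter J"
    using diameter_compact_attained[OF compact_J] by blast
  have "word_ratio c u * diameter J \<le> dist (Psi_comp S \<omega> u x) (Psi_comp S \<omega> u y)"
    using Psi_comp_expansion[OF u xy(1,2)] xy(3) by simp
  also have "\<dots> \<le> diameter (Jf u)"
    using xy u by (intro diameter_bounded_bound compact_imp_bounded compact_Jf) (auto simp: Jf_eq_image)
  finally show ?thesis .
qed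

lemma diameter_J_pos: "diameter J > 0"
proof -
  obtain a e where "e > 0" "ball a e \<subseteq> J" using interior_J mem_interior by blast
  then have "2 * e \<le> diameter J"
    using diameter_subset[of "ball a e" J] compact_imp_bounded[OF compact_J] by simp
  then show ?thesis using \<open>e > 0\<close> by simp
qed

text \<open>Two incomparable words branch at a common prefix \<open>w\<close>, which is a prefix of \<open>butlast u\<close>, so
  its ratio exceeds \<open>r\<close>.\<close>
lemma cut_set_separated:
  obtains \<delta> where "\<delta> > 0"
    "\<And>r u v x y. \<lbrakk>r > 0; u \<in> cut_set n c r; v \<in> cut_set n c r; u \<noteq> v; x \<in> Jf u; y \<in> Jf v\<rbrakk>
      \<Longrightarrow> dist x y \<ge> \<delta> * r"
proof -
  obtain C where C: "C > 0" and gapC: "\<And>w. w \<in> finite_words n \<Longrightarrow>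
      C * diameter (Jf w) \<le> Inf {dist x y | x y i j. i \<in> {1..n (Suc (length w))} \<and>
        j \<in> {1..n (Suc (length w))} \<and> i \<noteq> j \<and> x \<in> Jf (w @ [i]) \<and> y \<in> Jf (w @ [j])}"
    using gap unfolding gap_separation_condition_def by blast
  show ?thesis
  proof (rule that[of "C * diameter J"])
    fix r u v x y
    assume r: "r > 0" and u: "u \<in> cut_set n c r" and v: "v \<in> cut_set n c r" and "u \<noteq> v"
      and x: "x \<in> Jf u" and y: "y \<in> Jf v"
    obtain w u' v' where uv: "u = w @ u'" "v = w @ v'" "u' = [] \<or> v' = [] \<or> hd u' \<noteq> hd v'"
      using longest_common_prefix[of u v] by blast
    \<comment> \<open>Distinct members of the antichain are incomparable, so both words continue
      beyond their longest common prefix, with different letters.\<close>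
    have "u' \<noteq> []" using cut_set_antichain[of w r v'] u v uv \<open>u \<noteq> v\<close> by auto
    moreover have "v' \<noteq> []" using cut_set_antichain[of w r u'] u v uv \<open>u \<noteq> v\<close> by auto
    ultimately obtain i u'' j v'' where uv': "u' = i # u''" "v' = j # v''" "i \<noteq> j"
      using uv(3) by (metis list.exhaust list.sel(1))
    have u_eq: "u = (w @ [i]) @ u''" and v_eq: "v = (w @ [j]) @ v''" using uv uv' by auto
    have wi: "w @ [i] \<in> finite_words n" and wj: "w @ [j] \<in> finite_words n"
      using cut_setD(1)[OF u] cut_setD(1)[OF v] finite_words_appendD unfolding u_eq v_eq by blast+
    then have w: "w \<in> finite_words n" by simp
    have "r < word_ratio c w"
    proof -
      have eq: "butlast u = w @ butlast u'" and "(w @ butlast u') @ [last u'] = u"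
        using \<open>u' \<noteq> []\<close> by (simp_all add: uv butlast_append)
      then have "w @ butlast u' \<in> finite_words n"
        using cut_setD(1)[OF u] finite_words_appendD by metis
      then show ?thesis using word_ratio_append_le cut_setD(4)[OF u] eq by fastforce
    qed
    then have "C * diameter J * r \<le> C * (word_ratio c w * diameter J)"
      using C diameter_J_pos by simp
    also have "\<dots> \<le> C * diameter (Jf w)"
      using C diameter_Jf_ge[OF w] by simp
    also have "\<dots> \<le> dist x y"
    \<comment> \<open>The sets only shrink when words are extended, so \<open>x\<close> and
      \<open>y\<close> lie in two different children of \<open>Jf w\<close> and
      \<open>dist x y\<close> is one of the distances in the gap infimum.\<close>
    proof (rule order_trans[OF gapC[OF w]], rule cInf_lower)
      have "x \<in> Jf (w @ [i])" "y \<in> Jf (w @ [j])"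
        using x y Jf_append_subset cut_setD(1)[OF u] cut_setD(1)[OF v] unfolding u_eq v_eq by blast+
      then show "dist x y \<in> {dist x y | x y i j. i \<in> {1..n (Suc (length w))} \<and>
          j \<in> {1..n (Suc (length w))} \<and> i \<noteq> j \<and> x \<in> Jf (w @ [i]) \<and> y \<in> Jf (w @ [j])}"
        using wi wj uv'(3) by auto
    qed (auto intro!: bdd_belowI[of _ 0])
    finally show "dist x y \<ge> C * diameter J * r" .
  qed (use C diameter_J_pos in simp)
qed

text \<open>Nested nonempty compact sets with diameters tending to 0 meet in exactly one point, so
  the definite description in \<open>projection\<close> is meaningful. The second claim presents the
  projection as a limit of functions of finitely many letters, for use in proving
  measurability.\<close>

lemma projection_in_Jf:
  assumes w: "w \<in> infinite_words n"
  shows "projection Jf w \<in> Jf (prefix_of w k)"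
    and "(\<lambda>k. SOME x. x \<in> Jf (prefix_of w k)) \<longlonglongrightarrow> projection Jf w"
proof -
  let ?A = "\<lambda>k. Jf (prefix_of w k)"
  have fw: "prefix_of w k \<in> finite_words n" for k using w by simp
  have mono: "?A l \<subseteq> ?A k" if "k \<le> l" for k l
    using prefix_of_append[OF that, of w] Jf_append_subset fw by metis
  have "\<Inter> (range ?A) \<noteq> {}"
    by (rule compact_nest) (use fw compact_Jf Jf_nonempty mono in auto)
  then obtain p where p: "p \<in> ?A k" for k by auto
  have diam: "(\<lambda>k. diameter (?A k)) \<longlonglongrightarrow> 0"
  proof (rule tendsto_sandwich[OF _ _ tendsto_const diameter_tendsto])
    show "eventually (\<lambda>k. diameter (?A k) \<le> (MAX u\<in>words n k. diameter (Jf u))) sequentially"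
      using w by (intro always_eventually allI Max_ge) (auto simp: finite_words_of_length words_iff)
    show "eventually (\<lambda>k. 0 \<le> diameter (?A k)) sequentially"
      using fw by (intro always_eventually allI diameter_ge_0 compact_imp_bounded compact_Jf)
  qed
  \<comment> \<open>Used twice: for a constant sequence it gives uniqueness of the common point, for
    chosen points it gives the approximation. Level 0 is left out because the intersection in
    \<open>projection\<close> starts at level 1.\<close>
  have conv: "f \<longlonglongrightarrow> p" if f: "\<And>k. k \<ge> 1 \<Longrightarrow> f k \<in> ?A k" for f
  proof -
    have "eventually (\<lambda>k. dist (f k) p \<le> diameter (?A k)) sequentially"
      using eventually_ge_at_top[of 1]
      by eventually_elim (use f p fw in \<open>auto intro!: diameter_bounded_bound compact_imp_bounded compact_Jf\<close>)
    then have "(\<lambda>k. dist (f k) p) \<longlonglongrightarrow> 0"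
      by (intro tendsto_sandwich[OF _ _ tendsto_const diam]) auto
    then show ?thesis by (rule tendsto_dist_iff[THEN iffD2])
  qed
  have "x = p" if "x \<in> (\<Inter>k\<in>{1..}. ?A k)" for x
    using that by (intro LIMSEQ_unique[OF tendsto_const conv]) auto
  then have proj: "projection Jf w = p"
    unfolding projection_def using p by (intro the_equality) auto
  show "projection Jf w \<in> ?A k" using p proj by simp
  show "(\<lambda>k. SOME x. x \<in> ?A k) \<longlonglongrightarrow> projection Jf w"
    unfolding proj using p by (intro conv someI) auto
qed

lemma space_\<mu>: "space \<mu> = infinite_words n"
  using sets_eq_imp_space_eq[OF sets_\<mu>] by (simp add: space_word_borel)

lemma cylinder_measurable [measurable]: "cylinder n u \<in> sets \<mu>"
  by (simp add: sets_\<mu> cylinder_sets)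

text \<open>A pointwise limit of functions that factor through the prefix, hence through a discrete
  space on which every function is measurable.\<close>

lemma projection_measurable [measurable]: "projection Jf \<in> \<mu> \<rightarrow>\<^sub>M borel"
proof (rule borel_measurable_LIMSEQ_metric)
  show "(\<lambda>w. SOME x. x \<in> Jf (prefix_of w k)) \<in> \<mu> \<rightarrow>\<^sub>M borel" for k
  proof -
    have "(\<lambda>w. prefix_of w k) \<in> \<mu> \<rightarrow>\<^sub>M count_space UNIV"
      using prefix_of_measurable measurable_cong_sets[OF sets_\<mu> refl] by blast
    then show ?thesis by (rule measurable_compose) simp
  qed
  show "(\<lambda>k. SOME x. x \<in> Jf (prefix_of w k)) \<longlonglongrightarrow> projection Jf w" if "w \<in> space \<mu>" for w
    using that projection_in_Jf(2) by (simp add: space_\<mu>)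
qed

subsection \<open>Comparison of mesh sums and word sums\<close>

definition cell_mass :: "nat list \<Rightarrow> (real ^ 'd) set \<Rightarrow> real" where
  "cell_mass u Q = measure \<mu> (cylinder n u \<inter> (projection Jf -` Q \<inter> space \<mu>))"

text \<open>A finite family that carries all the mass, since projections stay in \<open>J\<close>;
  the infinite mesh sums reduce to sums over it.\<close>

definition hit_mesh :: "real \<Rightarrow> (real ^ 'd) set set" where
  "hit_mesh r = {Q \<in> mesh r. Q \<inter> J \<noteq> {}}"

lemma vimage_mesh_measurable: "Q \<in> mesh r \<Longrightarrow> projection Jf -` Q \<inter> space \<mu> \<in> sets \<mu>"
  by (rule measurable_sets[OF projection_measurable mesh_borel])

lemma finite_hit_mesh: "r > 0 \<Longrightarrow> finite (hit_mesh r)"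
  unfolding hit_mesh_def by (intro finite_mesh_meeting_bounded compact_imp_bounded compact_J)

lemma projection_in_J: "w \<in> space \<mu> \<Longrightarrow> projection Jf w \<in> J"
  using projection_in_Jf(1)[of w 0] by (simp add: space_\<mu> Jf_Nil)

lemma measure_image_mesh:
  "Q \<in> mesh r \<Longrightarrow> measure (image_measure \<mu> Jf) Q = measure \<mu> (projection Jf -` Q \<inter> space \<mu>)"
  unfolding image_measure_def by (rule measure_distr[OF projection_measurable mesh_borel])

text \<open>Column marginal: for \<open>0 < r < 1\<close> the cylinders over the cut set partition
  the word space.\<close>

lemma sum_cell_mass_cut_set:
  assumes "0 < r" "r < 1" "Q \<in> mesh r"
  shows "(\<Sum>u\<in>cut_set n c r. cell_mass u Q) = measure (image_measure \<mu> Jf) Q"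
proof -
  have "(\<Union>u\<in>cut_set n c r. cylinder n u \<inter> (projection Jf -` Q \<inter> space \<mu>)) = projection Jf -` Q \<inter> space \<mu>"
    using UN_cylinder_cut_set[OF assms(1,2)] by (auto simp: space_\<mu>)
  moreover have "measure \<mu> (\<Union>u\<in>cut_set n c r. cylinder n u \<inter> (projection Jf -` Q \<inter> space \<mu>))
      = (\<Sum>u\<in>cut_set n c r. cell_mass u Q)"
    unfolding cell_mass_def
    using finite_cut_set[OF assms(1)] vimage_mesh_measurable[OF assms(3)] disjoint_cylinders[of r]
    by (intro finite_measure_finite_Union) (auto simp: disjoint_family_on_def)
  ultimately show ?thesis using measure_image_mesh[OF assms(3)] by simp
qed

text \<open>Row marginal: the cubes are disjoint, and those meeting \<open>J\<close> already contain
  every projected point.\<close>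

lemma sum_cell_mass_mesh:
  assumes "r > 0"
  shows "(\<Sum>Q\<in>hit_mesh r. cell_mass u Q) = measure \<mu> (cylinder n u)"
proof -
  have "(\<Union>Q\<in>hit_mesh r. cylinder n u \<inter> (projection Jf -` Q \<inter> space \<mu>)) = cylinder n u"
  proof
    show "cylinder n u \<subseteq> (\<Union>Q\<in>hit_mesh r. cylinder n u \<inter> (projection Jf -` Q \<inter> space \<mu>))"
    proof
      fix w assume w: "w \<in> cylinder n u"
      then have sp: "w \<in> space \<mu>" by (simp add: space_\<mu> cylinder_def)
      obtain Q where "Q \<in> mesh r" "projection Jf w \<in> Q" using mesh_covers[OF assms] .
      then show "w \<in> (\<Union>Q\<in>hit_mesh r. cylinder n u \<inter> (projection Jf -` Q \<inter> space \<mu>))"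
        using w sp projection_in_J[OF sp] by (auto simp: hit_mesh_def)
    qed
  qed auto
  moreover have "measure \<mu> (\<Union>Q\<in>hit_mesh r. cylinder n u \<inter> (projection Jf -` Q \<inter> space \<mu>))
      = (\<Sum>Q\<in>hit_mesh r. cell_mass u Q)"
    unfolding cell_mass_def
  proof (rule finite_measure_finite_Union[OF finite_hit_mesh[OF assms]])
    show "(\<lambda>Q. cylinder n u \<inter> (projection Jf -` Q \<inter> space \<mu>)) ` hit_mesh r \<subseteq> sets \<mu>"
      using vimage_mesh_measurable by (auto simp: hit_mesh_def)
    show "disjoint_family_on (\<lambda>Q. cylinder n u \<inter> (projection Jf -` Q \<inter> space \<mu>)) (hit_mesh r)"
      using disjoint_family_on_mesh[OF assms] by (fastforce simp: disjoint_family_on_def hit_mesh_def)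
  qed
  ultimately show ?thesis by simp
qed

lemma sum_measure_cylinder:
  assumes "0 < r" "r < 1"
  shows "(\<Sum>u\<in>cut_set n c r. measure \<mu> (cylinder n u)) = measure \<mu> (space \<mu>)"
proof -
  have "measure \<mu> (\<Union>u\<in>cut_set n c r. cylinder n u) = (\<Sum>u\<in>cut_set n c r. measure \<mu> (cylinder n u))"
    using finite_cut_set[OF assms(1)] disjoint_cylinders by (intro finite_measure_finite_Union) auto
  then show ?thesis by (simp add: UN_cylinder_cut_set[OF assms] space_\<mu>)
qed

lemma infsum_mesh:
  fixes g :: "real \<Rightarrow> real"
  assumes "g 0 = 0" "r > 0"
  shows "(\<Sum>\<^sub>\<infinity>Q\<in>mesh r. g (measure (image_measure \<mu> Jf) Q))
    = (\<Sum>Q\<in>hit_mesh r. g (measure (image_measure \<mu> Jf) Q))"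
proof -
  have "measure (image_measure \<mu> Jf) Q = 0" if "Q \<in> mesh r - hit_mesh r" for Q
  proof -
    have "projection Jf -` Q \<inter> space \<mu> = {}"
      using that projection_in_J by (auto simp: hit_mesh_def)
    then show ?thesis using that measure_image_mesh[of Q r] by simp
  qed
  then have "(\<Sum>\<^sub>\<infinity>Q\<in>mesh r. g (measure (image_measure \<mu> Jf) Q))
      = (\<Sum>\<^sub>\<infinity>Q\<in>hit_mesh r. g (measure (image_measure \<mu> Jf) Q))"
    using assms(1) by (intro infsum_cong_neutral) (auto simp: hit_mesh_def)
  then show ?thesis using finite_hit_mesh[OF assms(2)] by simp
qed

text \<open>A nonzero entry yields an infinite word through \<open>u\<close> whose projection lies
  in both \<open>Q\<close> and \<open>Jf u\<close>. Choosing one such point for each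
  \<open>u\<close> gives a separated family inside a single cube.\<close>

lemma card_words_in_mesh_cube:
  obtains N :: nat where "N > 0"
    "\<And>r Q. \<lbrakk>r > 0; Q \<in> mesh r\<rbrakk> \<Longrightarrow> card {u \<in> cut_set n c r. cell_mass u Q \<noteq> 0} \<le> N"
proof -
  obtain \<delta> where \<delta>: "\<delta> > 0" and sep:
    "\<And>r u v x y. \<lbrakk>r > 0; u \<in> cut_set n c r; v \<in> cut_set n c r; u \<noteq> v; x \<in> Jf u; y \<in> Jf v\<rbrakk>
      \<Longrightarrow> dist x y \<ge> \<delta> * r"
    using cut_set_separated by blast
  obtain N :: nat where N: "N > 0" "\<forall>r Q U (p :: nat list \<Rightarrow> real ^ 'd). r > 0 \<longrightarrow> Q \<in> mesh r \<longrightarrow>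
      p ` U \<subseteq> Q \<longrightarrow> pairwise (\<lambda>u v. dist (p u) (p v) \<ge> \<delta> * r) U \<longrightarrow> card U \<le> N"
    using card_separated_in_mesh_cube[OF \<delta>] by blast
  show ?thesis
  proof (rule that[OF N(1)])
    fix r :: real and Q :: "(real ^ 'd) set" assume r: "r > 0" and Q: "Q \<in> mesh r"
    let ?U = "{u \<in> cut_set n c r. cell_mass u Q \<noteq> 0}"
    have "\<exists>p. p \<in> Q \<and> p \<in> Jf u" if "u \<in> ?U" for u
    proof -
      have "cylinder n u \<inter> (projection Jf -` Q \<inter> space \<mu>) \<noteq> {}"
        using that by (auto simp: cell_mass_def)
      then obtain w where "w \<in> cylinder n u" "projection Jf w \<in> Q" by auto
      then show ?thesis using projection_in_Jf(1)[of w "length u"] by (auto simp: cylinder_def)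
    qed
    then obtain p where "\<And>u. u \<in> ?U \<Longrightarrow> p u \<in> Q \<and> p u \<in> Jf u" by metis
    then have "p ` ?U \<subseteq> Q" and "pairwise (\<lambda>u v. dist (p u) (p v) \<ge> \<delta> * r) ?U"
      using sep[OF r] by (auto intro!: pairwiseI)
    then show "card ?U \<le> N" using N(2) r Q by blast
  qed
qed

abbreviation "\<nu> \<equiv> image_measure \<mu> Jf"

abbreviation "mass \<equiv> measure \<mu> (space \<mu>)"

text \<open>The matrix inequalities for \<open>cell_mass\<close>, with one \<open>N\<close> for all
  scales and exponents. As \<open>(q - 1) * ln r\<close> changes sign at \<open>q = 1\<close>, an
  upper bound on cube sums for \<open>q >= 1\<close> and a lower bound for \<open>q < 1\<close> both
  bound the dimension quotient from below.\<close>

lemma mesh_sum_comparison: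
  obtains N :: nat where "N > 0"
    "\<And>r q. \<lbrakk>0 < r; r < 1; q \<ge> 1\<rbrakk> \<Longrightarrow>
      (\<Sum>Q\<in>hit_mesh r. measure \<nu> Q powr q) \<le> N powr q * (\<Sum>u\<in>cut_set n c r. measure \<mu> (cylinder n u) powr q)"
    "\<And>r q. \<lbrakk>0 < r; r < 1; 0 < q; q \<le> 1\<rbrakk> \<Longrightarrow>
      (\<Sum>u\<in>cut_set n c r. measure \<mu> (cylinder n u) powr q) \<le> N * (\<Sum>Q\<in>hit_mesh r. measure \<nu> Q powr q)"
    "\<And>r. \<lbrakk>0 < r; r < 1\<rbrakk> \<Longrightarrow>
      (\<Sum>Q\<in>hit_mesh r. measure \<nu> Q * ln (measure \<nu> Q))
        \<le> (\<Sum>u\<in>cut_set n c r. measure \<mu> (cylinder n u) * ln (measure \<mu> (cylinder n u))) + mass * ln N"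
proof -
  obtain N :: nat where N: "N > 0"
    "\<And>r Q. \<lbrakk>r > 0; Q \<in> mesh r\<rbrakk> \<Longrightarrow> card {u \<in> cut_set n c r. cell_mass u Q \<noteq> 0} \<le> N"
    using card_words_in_mesh_cube by blast
  have nonneg: "cell_mass u Q \<ge> 0" for u Q by (simp add: cell_mass_def)
  have col: "measure \<nu> Q = (\<Sum>u\<in>cut_set n c r. cell_mass u Q)" if "0 < r" "r < 1" "Q \<in> hit_mesh r" for r Q
    using that by (simp add: sum_cell_mass_cut_set hit_mesh_def)
  have row: "measure \<mu> (cylinder n u) = (\<Sum>Q\<in>hit_mesh r. cell_mass u Q)" if "0 < r" for r u
    using that by (simp add: sum_cell_mass_mesh)
  show ?thesis
  proof (rule that[OF N(1)])
    fix r q :: real assume r: "0 < r" "r < 1" and q: "q \<ge> 1"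
    show "(\<Sum>Q\<in>hit_mesh r. measure \<nu> Q powr q) \<le> N powr q * (\<Sum>u\<in>cut_set n c r. measure \<mu> (cylinder n u) powr q)"
      using column_powr_le_row_powr[where N = N and q = q and x = cell_mass, OF finite_cut_set[OF r(1)] finite_hit_mesh[OF r(1)] nonneg] N(2) q r
      by (simp add: col row[OF r(1)] hit_mesh_def)
  next
    fix r q :: real assume r: "0 < r" "r < 1" and q: "0 < q" "q \<le> 1"
    show "(\<Sum>u\<in>cut_set n c r. measure \<mu> (cylinder n u) powr q) \<le> N * (\<Sum>Q\<in>hit_mesh r. measure \<nu> Q powr q)"
      using row_powr_le_column_powr[where N = N and q = q and x = cell_mass, OF finite_cut_set[OF r(1)] finite_hit_mesh[OF r(1)] nonneg] N(2) q r
      by (simp add: col row[OF r(1)] hit_mesh_def)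
  next
    fix r :: real assume r: "0 < r" "r < 1"
    show "(\<Sum>Q\<in>hit_mesh r. measure \<nu> Q * ln (measure \<nu> Q))
        \<le> (\<Sum>u\<in>cut_set n c r. measure \<mu> (cylinder n u) * ln (measure \<mu> (cylinder n u))) + mass * ln N"
      using column_entropy_le_row_entropy[where N = N and x = cell_mass, OF finite_cut_set[OF r(1)] finite_hit_mesh[OF r(1)] nonneg] N r
      by (simp add: col row[OF r(1)] hit_mesh_def flip: sum_measure_cylinder[OF r])
  qed
qed

lemma sum_measure_mesh:
  assumes "0 < r" "r < 1"
  shows "(\<Sum>Q\<in>hit_mesh r. measure \<nu> Q) = mass"
proof -
  have "(\<Sum>Q\<in>hit_mesh r. measure \<nu> Q) = (\<Sum>Q\<in>hit_mesh r. \<Sum>u\<in>cut_set n c r. cell_mass u Q)"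
    using assms by (intro sum.cong) (auto simp: sum_cell_mass_cut_set hit_mesh_def)
  also have "\<dots> = (\<Sum>u\<in>cut_set n c r. \<Sum>Q\<in>hit_mesh r. cell_mass u Q)"
    by (rule sum.swap)
  finally show ?thesis using assms by (simp add: sum_cell_mass_mesh sum_measure_cylinder)
qed

text \<open>Positivity is needed before logarithms of this sum are compared. The total number of
  cubes may serve as \<open>N\<close>, since the size of the lower bound is irrelevant here.\<close>

lemma mesh_powr_sum_pos:
  assumes "0 < r" "r < 1" "mass > 0" "q > 0"
  shows "(\<Sum>Q\<in>hit_mesh r. measure \<nu> Q powr q) > 0"
proof -
  have "mass powr q \<le> real (card (hit_mesh r)) powr q * (\<Sum>Q\<in>hit_mesh r. measure \<nu> Q powr q)"
    using powr_sum_le_card_powr[of "hit_mesh r" "measure \<nu>" "card (hit_mesh r)" q] assms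
    by (simp add: sum_measure_mesh finite_hit_mesh card_mono)
  moreover have "mass powr q > 0" using assms by simp
  ultimately have "(\<Sum>Q\<in>hit_mesh r. measure \<nu> Q powr q) \<noteq> 0" by auto
  moreover have "(\<Sum>Q\<in>hit_mesh r. measure \<nu> Q powr q) \<ge> 0" by (intro sum_nonneg) auto
  ultimately show ?thesis by linarith
qed

section \<open>From word sums to dimension quotients\<close>

lemma dim_quotient_eq:
  "r > 0 \<Longrightarrow> dim_quotient q \<nu> r =
     (if q = 1 then (\<Sum>Q\<in>hit_mesh r. measure \<nu> Q * ln (measure \<nu> Q)) / ln r
      else ln (\<Sum>Q\<in>hit_mesh r. measure \<nu> Q powr q) / ((q - 1) * ln r))"
  using infsum_mesh[of "\<lambda>x. x * ln x" r] infsum_mesh[of "\<lambda>x. x powr q" r]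
  by (simp add: dim_quotient_def)

text \<open>Ratios on the cut set are at most \<open>r\<close>, so a bound on \<open>F_sum\<close>
  bounds the plain cylinder sum, and the comparison carries this over to cubes. As \<open>B\<close>
  does not depend on \<open>r\<close>, the estimate serves both bounds holding eventually and bounds
  holding frequently.\<close>

lemma dim_quotient_ge:
  assumes q: "q \<ge> 1" and s: "s \<ge> 0" and K: "K > 0" and mass_pos: "mass > 0" "q = 1 \<Longrightarrow> mass \<ge> 1"
  obtains B where
    "\<And>r. \<lbrakk>0 < r; r < 1; F_sum n c \<mu> q s r \<le> K\<rbrakk> \<Longrightarrow> s + B / ln r \<le> dim_quotient q \<nu> r"
proof -
  obtain N :: nat where N: "N > 0" and powr_le: "\<And>r q. \<lbrakk>0 < r; r < 1; q \<ge> 1\<rbrakk> \<Longrightarrow>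
      (\<Sum>Q\<in>hit_mesh r. measure \<nu> Q powr q) \<le> N powr q * (\<Sum>u\<in>cut_set n c r. measure \<mu> (cylinder n u) powr q)"
    and "\<And>r q. \<lbrakk>0 < r; r < 1; 0 < q; q \<le> 1\<rbrakk> \<Longrightarrow>
      (\<Sum>u\<in>cut_set n c r. measure \<mu> (cylinder n u) powr q) \<le> N * (\<Sum>Q\<in>hit_mesh r. measure \<nu> Q powr q)"
    and entropy_le: "\<And>r. \<lbrakk>0 < r; r < 1\<rbrakk> \<Longrightarrow>
      (\<Sum>Q\<in>hit_mesh r. measure \<nu> Q * ln (measure \<nu> Q))
        \<le> (\<Sum>u\<in>cut_set n c r. measure \<mu> (cylinder n u) * ln (measure \<mu> (cylinder n u))) + mass * ln N"
    using mesh_sum_comparison by blast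
  show ?thesis
  proof (cases "q = 1")
    case True
    show ?thesis
    \<comment> \<open>\<open>K\<close> comes from the word sum, \<open>mass * ln N\<close> from
      merging at most \<open>N\<close> words in each cube.\<close>
    proof (rule that[of "K + mass * ln N"])
      fix r :: real assume r: "0 < r" "r < 1" and F: "F_sum n c \<mu> q s r \<le> K"
      let ?H = "\<Sum>Q\<in>hit_mesh r. measure \<nu> Q * ln (measure \<nu> Q)"
      let ?m = "\<lambda>u. measure \<mu> (cylinder n u)"
      have "?m u * ln (?m u) - s * ln r * ?m u \<le> ?m u * ln (word_ratio c u powr (- s) * ?m u)"
        if u: "u \<in> cut_set n c r" for u
      proof (cases "?m u = 0")
        case False
        then have m: "?m u > 0" by (simp add: zero_less_measure_iff)
        have "ln (word_ratio c u powr (- s) * ?m u) = ln (?m u) - s * ln (word_ratio c u)"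
          using m cut_setD(2)[OF u] by (simp add: ln_mult ln_powr)
        moreover have "s * ln (word_ratio c u) \<le> s * ln r"
          using cut_setD(2,3)[OF u] r s by (intro mult_left_mono) auto
        ultimately have "?m u * (ln (?m u) - s * ln r) \<le> ?m u * ln (word_ratio c u powr (- s) * ?m u)"
          using m by (intro mult_left_mono) auto
        then show ?thesis by (simp add: algebra_simps)
      qed simp
      then have "(\<Sum>u\<in>cut_set n c r. ?m u * ln (?m u) - s * ln r * ?m u) \<le> F_sum n c \<mu> q s r"
        unfolding F_sum_def using True by (simp add: sum_mono)
      then have "(\<Sum>u\<in>cut_set n c r. ?m u * ln (?m u)) \<le> K + s * mass * ln r"
        using F sum_measure_cylinder[OF r]
        by (simp add: sum_subtractf algebra_simps flip: sum_distrib_left)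
      then have "?H \<le> (K + mass * ln N) + s * mass * ln r"
        using entropy_le[OF r] by linarith
      moreover have lr: "ln r < 0" using r by simp
      ultimately have "((K + mass * ln N) + s * mass * ln r) / ln r \<le> ?H / ln r"
        by (intro divide_right_mono_neg) auto
      moreover have "((K + mass * ln N) + s * mass * ln r) / ln r = (K + mass * ln N) / ln r + s * mass"
        using lr by (simp add: add_divide_distrib)
      \<comment> \<open>For \<open>q = 1\<close> the sums are not normalised: division by
        \<open>ln r\<close> leaves \<open>s * mass\<close> as leading term, and total mass at least
        1 is what brings this above \<open>s\<close>.\<close>
      moreover have "s * 1 \<le> s * mass" using mass_pos(2)[OF True] s by (intro mult_left_mono)
      ultimately show "s + (K + mass * ln N) / ln r \<le> dim_quotient q \<nu> r"
        using True r by (simp add: dim_quotient_eq)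
    qed
  next
    case False
    then have q1: "q > 1" using q by simp
    show ?thesis
    proof (rule that[of "ln (N powr q * K) / (q - 1)"])
      fix r :: real assume r: "0 < r" "r < 1" and F: "F_sum n c \<mu> q s r \<le> K"
      let ?Z = "\<Sum>Q\<in>hit_mesh r. measure \<nu> Q powr q"
      let ?M = "\<Sum>u\<in>cut_set n c r. measure \<mu> (cylinder n u) powr q"
      \<comment> \<open>The exponent is nonpositive, so replacing the ratio by the larger
        \<open>r\<close> lowers the power.\<close>
      have "r powr (s * (1 - q)) \<le> word_ratio c u powr (s * (1 - q))" if u: "u \<in> cut_set n c r" for u
        using cut_setD(2,3)[OF u] q1 s by (intro powr_mono2') (auto intro: mult_nonneg_nonpos)
      then have "r powr (s * (1 - q)) * ?M \<le> F_sum n c \<mu> q s r"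
        unfolding F_sum_def using False by (auto simp: sum_distrib_left intro!: sum_mono mult_right_mono)
      then have "r powr (s * (1 - q)) * ?M \<le> K" using F by simp
      then have "r powr (s * (q - 1)) * (r powr (s * (1 - q)) * ?M) \<le> r powr (s * (q - 1)) * K"
        by (intro mult_left_mono) auto
      moreover have "r powr (s * (q - 1)) * r powr (s * (1 - q)) = 1"
        using r by (simp add: algebra_simps flip: powr_add)
      ultimately have "?M \<le> r powr (s * (q - 1)) * K" by (simp flip: mult.assoc)
      then have "N powr q * ?M \<le> N powr q * (r powr (s * (q - 1)) * K)"
        by (intro mult_left_mono) auto
      then have "?Z \<le> (N powr q * K) * r powr (s * (q - 1))"
        using powr_le[OF r q] by (simp add: mult_ac)
      moreover have "?Z > 0" using r mass_pos q by (intro mesh_powr_sum_pos) auto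
      ultimately have "ln ?Z \<le> ln ((N powr q * K) * r powr (s * (q - 1)))" by simp
      also have "\<dots> = ln (N powr q * K) + s * (q - 1) * ln r"
        using N K r by (subst ln_mult) (auto simp: ln_powr)
      finally have "(ln (N powr q * K) + s * (q - 1) * ln r) / ((q - 1) * ln r) \<le> ln ?Z / ((q - 1) * ln r)"
        using q1 r by (intro divide_right_mono_neg) (auto simp: mult_le_0_iff)
      moreover have "(ln (N powr q * K) + s * (q - 1) * ln r) / ((q - 1) * ln r)
          = s + ln (N powr q * K) / (q - 1) / ln r"
        using q1 r by (simp add: field_simps)
      ultimately show "s + ln (N powr q * K) / (q - 1) / ln r \<le> dim_quotient q \<nu> r"
        using False r by (simp add: dim_quotient_eq)
    qed
  qed
qed

text \<open>At \<open>s = 0\<close> the ratios drop out and only the total mass matters. This makes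
  0 an admissible parameter, matching the 0 inserted into the suprema for \<open>q >= 1\<close>; the
  maximum covers both forms of the sum.\<close>

lemma F_sum_zero_le:
  assumes "q \<ge> 1" "0 < r" "r < 1"
  shows "F_sum n c \<mu> q 0 r \<le> max (mass powr q) (mass * ln mass)"
proof (cases "q = 1")
  case True
  have "F_sum n c \<mu> q 0 r
      = (\<Sum>u\<in>cut_set n c r. measure \<mu> (cylinder n u) * ln (measure \<mu> (cylinder n u)))"
    unfolding F_sum_def using True by (auto intro!: sum.cong dest: cut_setD(2))
  also have "\<dots> \<le> mass * ln mass"
    using sum_mult_ln_le[OF finite_cut_set[OF assms(2)], of "\<lambda>u. measure \<mu> (cylinder n u)"]
    by (simp add: sum_measure_cylinder assms)
  finally show ?thesis by simp
next
  case False
  have "F_sum n c \<mu> q 0 r = (\<Sum>u\<in>cut_set n c r. measure \<mu> (cylinder n u) powr q)"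
    unfolding F_sum_def using False by (auto intro!: sum.cong dest: cut_setD(2))
  also have "\<dots> \<le> mass powr q"
    using sum_powr_le_powr_sum[OF finite_cut_set[OF assms(2)], of "\<lambda>u. measure \<mu> (cylinder n u)" q]
    by (simp add: sum_measure_cylinder assms)
  finally show ?thesis by simp
qed

text \<open>Here \<open>(q - 1) * ln r\<close> is positive, so a quotient below \<open>t\<close>
  bounds the cube sum by \<open>r powr (t * (q - 1))\<close>. The factor
  \<open>r powr (t * (1 - q))\<close> from the ratios cancels this, and the constant
  \<open>N\<close> is left for every \<open>r\<close> and \<open>t\<close>.\<close>

lemma F_sum_le:
  assumes q: "0 < q" "q < 1" and mass_pos: "mass > 0"
  obtains K where "\<And>r t. \<lbrakk>0 < r; r < 1; t > 0; dim_quotient q \<nu> r < t\<rbrakk> \<Longrightarrow> F_sum n c \<mu> q t r \<le> K"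
proof -
  obtain N :: nat where N: "N > 0" and "\<And>r q. \<lbrakk>0 < r; r < 1; q \<ge> 1\<rbrakk> \<Longrightarrow>
      (\<Sum>Q\<in>hit_mesh r. measure \<nu> Q powr q) \<le> N powr q * (\<Sum>u\<in>cut_set n c r. measure \<mu> (cylinder n u) powr q)"
    and powr_le: "\<And>r q. \<lbrakk>0 < r; r < 1; 0 < q; q \<le> 1\<rbrakk> \<Longrightarrow>
      (\<Sum>u\<in>cut_set n c r. measure \<mu> (cylinder n u) powr q) \<le> N * (\<Sum>Q\<in>hit_mesh r. measure \<nu> Q powr q)"
    and "\<And>r. \<lbrakk>0 < r; r < 1\<rbrakk> \<Longrightarrow>
      (\<Sum>Q\<in>hit_mesh r. measure \<nu> Q * ln (measure \<nu> Q))
        \<le> (\<Sum>u\<in>cut_set n c r. measure \<mu> (cylinder n u) * ln (measure \<mu> (cylinder n u))) + mass * ln N"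
    using mesh_sum_comparison by blast
  show ?thesis
  proof (rule that[of N])
    fix r t :: real assume r: "0 < r" "r < 1" and t: "t > 0" and dq: "dim_quotient q \<nu> r < t"
    let ?Z = "\<Sum>Q\<in>hit_mesh r. measure \<nu> Q powr q"
    let ?M = "\<Sum>u\<in>cut_set n c r. measure \<mu> (cylinder n u) powr q"
    have Z: "?Z > 0" using r q mass_pos by (intro mesh_powr_sum_pos)
    have "(q - 1) * ln r > 0" using q r by (intro mult_neg_neg) auto
    then have "ln ?Z < t * ((q - 1) * ln r)"
      using dq q r by (simp add: dim_quotient_eq pos_divide_less_eq)
    then have "?Z < exp (t * ((q - 1) * ln r))" using Z by (metis exp_less_cancel_iff exp_ln)
    also have "\<dots> = r powr (t * (q - 1))" using r by (simp add: powr_def mult_ac)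
    finally have Z_le: "?Z \<le> r powr (t * (q - 1))" by simp
    have "word_ratio c u powr (t * (1 - q)) \<le> r powr (t * (1 - q))" if u: "u \<in> cut_set n c r" for u
      using cut_setD(2,3)[OF u] q t by (intro powr_mono2) auto
    then have "F_sum n c \<mu> q t r \<le> r powr (t * (1 - q)) * ?M"
      unfolding F_sum_def using q by (auto simp: sum_distrib_left intro!: sum_mono mult_right_mono)
    also have "\<dots> \<le> r powr (t * (1 - q)) * (N * ?Z)"
      using r q by (intro mult_left_mono powr_le) auto
    also have "\<dots> \<le> r powr (t * (1 - q)) * (N * r powr (t * (q - 1)))"
      using Z_le by (intro mult_left_mono) auto
    also have "\<dots> = N * (r powr (t * (1 - q)) * r powr (t * (q - 1)))" by simp
    also have "r powr (t * (1 - q)) * r powr (t * (q - 1)) = 1"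
      using r by (simp add: algebra_simps flip: powr_add)
    finally show "F_sum n c \<mu> q t r \<le> N" by simp
  qed
qed

text \<open>Subadditivity keeps the cube sum above the constant \<open>mass powr q\<close>. The
  critical values for \<open>q < 1\<close> are infima over positive \<open>s\<close>; this lemma
  ensures that a real above the dimension is such an \<open>s\<close>.\<close>

lemma lower_q_dim_nonneg:
  assumes q: "0 < q" "q < 1" and mass_pos: "mass > 0"
  shows "lower_q_dim q \<nu> \<ge> 0"
proof -
  have bound: "0 + (q * ln mass / (q - 1)) / ln r \<le> dim_quotient q \<nu> r" if r: "0 < r" "r < 1" for r
  proof -
    let ?Z = "\<Sum>Q\<in>hit_mesh r. measure \<nu> Q powr q"
    have "mass powr q \<le> ?Z"
      using powr_sum_le_sum_powr[OF finite_hit_mesh[OF r(1)], of "measure \<nu>" q] q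
      by (simp add: sum_measure_mesh r)
    moreover have "mass powr q > 0" using mass_pos by simp
    ultimately have "ln (mass powr q) \<le> ln ?Z" by (subst ln_le_cancel_iff) linarith+
    then have "q * ln mass / ((q - 1) * ln r) \<le> ln ?Z / ((q - 1) * ln r)"
      using q r mass_pos by (intro divide_right_mono) (auto simp: ln_powr intro!: mult_nonpos_nonpos)
    then show ?thesis using q r by (simp add: dim_quotient_eq)
  qed
  from eventually_at_right_0_less_1 have "eventually (\<lambda>r. 0 + (q * ln mass / (q - 1)) / ln r \<le> dim_quotient q \<nu> r) (at_right 0)"
    by (rule eventually_mono) (use bound in blast)
  from le_Liminf_of_eventually[OF this tendsto_add_divide_ln_at_right_0] show ?thesis
    by (simp add: lower_q_dim_def zero_ereal_def)
qed

section \<open>Passage to the limit and the critical values\<close>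

lemma le_lower_q_dim:
  assumes "q \<ge> 1" "s \<ge> 0" "mass > 0" "q = 1 \<Longrightarrow> mass \<ge> 1" "F_limsup n c \<mu> q s < \<infinity>"
  shows "ereal s \<le> lower_q_dim q \<nu>"
proof -
  obtain K where K: "K > 0" "eventually (\<lambda>r. F_sum n c \<mu> q s r \<le> K) (at_right 0)"
    using eventually_le_of_Limsup_less_PInf assms(5) unfolding F_limsup_def by blast
  obtain B where B: "\<And>r. \<lbrakk>0 < r; r < 1; F_sum n c \<mu> q s r \<le> K\<rbrakk> \<Longrightarrow> s + B / ln r \<le> dim_quotient q \<nu> r"
    using dim_quotient_ge[OF assms(1,2) K(1) assms(3,4)] by blast
  have "eventually (\<lambda>r. s + B / ln r \<le> dim_quotient q \<nu> r) (at_right 0)"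
    using K(2) eventually_at_right_0_less_1 by eventually_elim (use B in blast)
  then show ?thesis
    unfolding lower_q_dim_def
    by (rule le_Liminf_of_eventually[OF _ tendsto_add_divide_ln_at_right_0]) simp
qed

lemma le_upper_q_dim:
  assumes "q \<ge> 1" "s \<ge> 0" "mass > 0" "q = 1 \<Longrightarrow> mass \<ge> 1" "F_liminf n c \<mu> q s < \<infinity>"
  shows "ereal s \<le> upper_q_dim q \<nu>"
proof -
  obtain K where K: "K > 0" "frequently (\<lambda>r. F_sum n c \<mu> q s r \<le> K) (at_right 0)"
    using frequently_le_of_Liminf_less_PInf assms(5) unfolding F_liminf_def by blast
  obtain B where B: "\<And>r. \<lbrakk>0 < r; r < 1; F_sum n c \<mu> q s r \<le> K\<rbrakk> \<Longrightarrow> s + B / ln r \<le> dim_quotient q \<nu> r"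
    using dim_quotient_ge[OF assms(1,2) K(1) assms(3,4)] by blast
  have "frequently (\<lambda>r. s + B / ln r \<le> dim_quotient q \<nu> r) (at_right 0)"
    using frequently_eventually_frequently[OF K(2) eventually_at_right_0_less_1] by (rule frequently_elim1) (use B in blast)
  then show ?thesis
    unfolding upper_q_dim_def
    by (rule le_Limsup_of_frequently[OF _ tendsto_add_divide_ln_at_right_0])
qed

lemma F_zero_finite:
  assumes "q \<ge> 1"
  shows "F_limsup n c \<mu> q 0 < \<infinity>" "F_liminf n c \<mu> q 0 < \<infinity>"
proof -
  have "F_limsup n c \<mu> q 0 \<le> ereal (max (mass powr q) (mass * ln mass))"
    unfolding F_limsup_def
    by (intro Limsup_bounded eventually_mono[OF eventually_at_right_0_less_1]) (use F_sum_zero_le[OF assms] in \<open>auto simp del: ereal_max\<close>)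
  then show "F_limsup n c \<mu> q 0 < \<infinity>" by (rule le_less_trans) (simp del: ereal_max)
  then show "F_liminf n c \<mu> q 0 < \<infinity>"
    using Liminf_le_Limsup[of "at_right (0::real)" "\<lambda>r. ereal (F_sum n c \<mu> q 0 r)"]
    unfolding F_limsup_def F_liminf_def by (auto intro: le_less_trans)
qed

lemma F_liminf_finite:
  assumes "0 < q" "q < 1" "mass > 0" "t > 0" "lower_q_dim q \<nu> < ereal t"
  shows "F_liminf n c \<mu> q t < \<infinity>"
proof -
  obtain K where K: "\<And>r t. \<lbrakk>0 < r; r < 1; t > 0; dim_quotient q \<nu> r < t\<rbrakk> \<Longrightarrow> F_sum n c \<mu> q t r \<le> K"
    using F_sum_le[OF assms(1-3)] by blast
  have "frequently (\<lambda>r. ereal (dim_quotient q \<nu> r) < ereal t) (at_right 0)"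
    using assms(5) unfolding lower_q_dim_def by (rule frequently_less_of_Liminf_less)
  from frequently_eventually_frequently[OF this eventually_at_right_0_less_1]
  have "frequently (\<lambda>r. ereal (F_sum n c \<mu> q t r) \<le> ereal K) (at_right 0)"
    by (rule frequently_elim1) (use K assms(4) in auto)
  from Liminf_le_of_frequently[OF this] show ?thesis
    unfolding F_liminf_def by (auto intro: le_less_trans)
qed

lemma F_limsup_finite:
  assumes "0 < q" "q < 1" "mass > 0" "t > 0" "upper_q_dim q \<nu> < ereal t"
  shows "F_limsup n c \<mu> q t < \<infinity>"
proof -
  obtain K where K: "\<And>r t. \<lbrakk>0 < r; r < 1; t > 0; dim_quotient q \<nu> r < t\<rbrakk> \<Longrightarrow> F_sum n c \<mu> q t r \<le> K"
    using F_sum_le[OF assms(1-3)] by blast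
  have "eventually (\<lambda>r. ereal (dim_quotient q \<nu> r) < ereal t) (at_right 0)"
    using assms(5) unfolding upper_q_dim_def by (rule Limsup_lessD)
  then have "eventually (\<lambda>r. ereal (F_sum n c \<mu> q t r) \<le> ereal K) (at_right 0)"
    using eventually_at_right_0_less_1 by eventually_elim (use K assms(4) in auto)
  from Limsup_bounded[OF this] show ?thesis
    unfolding F_limsup_def by (auto intro: le_less_trans)
qed

text \<open>For \<open>q >= 1\<close> every admissible \<open>s\<close>, and the inserted 0, lies
  below the dimension. For \<open>q < 1\<close> a real \<open>t\<close> strictly between the
  dimension and the critical value would itself be admissible, contradicting the infimum.\<close>

lemma d_minus_le_lower_q_dim:
  assumes "q > 0" "mass > 0" "q = 1 \<Longrightarrow> mass \<ge> 1"
  shows "d_minus n c \<mu> q \<le> lower_q_dim q \<nu>"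
proof (cases "q \<ge> 1")
  case True
  then show ?thesis
    using assms le_lower_q_dim[of q] F_zero_finite(1)[of q]
    by (auto simp: d_minus_def zero_ereal_def intro!: Sup_least)
next
  case False
  then have q: "0 < q" "q < 1" using assms by auto
  show ?thesis
  proof (rule ccontr)
    assume "\<not> ?thesis"
    then obtain t where t: "lower_q_dim q \<nu> < ereal t" "ereal t < d_minus n c \<mu> q"
      using ereal_dense2 by (auto simp: not_le)
    then have "t > 0" using lower_q_dim_nonneg[OF q assms(2)] le_less_trans by fastforce
    then have "d_minus n c \<mu> q \<le> ereal t"
      using False F_liminf_finite[OF q assms(2) _ t(1)] by (auto simp: d_minus_def intro!: Inf_lower)
    then show False using t(2) by simp
  qed
qed

lemma d_plus_le_upper_q_dim:
  assumes "q > 0" "mass > 0" "q = 1 \<Longrightarrow> mass \<ge> 1"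
  shows "d_plus n c \<mu> q \<le> upper_q_dim q \<nu>"
proof (cases "q \<ge> 1")
  case True
  then show ?thesis
    using assms le_upper_q_dim[of q] F_zero_finite(2)[of q]
    by (auto simp: d_plus_def zero_ereal_def intro!: Sup_least)
next
  case False
  then have q: "0 < q" "q < 1" using assms by auto
  show ?thesis
  proof (rule ccontr)
    assume "\<not> ?thesis"
    then obtain t where t: "upper_q_dim q \<nu> < ereal t" "ereal t < d_plus n c \<mu> q"
      using ereal_dense2 by (auto simp: not_le)
    \<comment> \<open>The upper dimension inherits nonnegativity from the lower one, so
      \<open>t\<close> is positive.\<close>
    have "lower_q_dim q \<nu> \<le> upper_q_dim q \<nu>"
      unfolding lower_q_dim_def upper_q_dim_def by (rule Liminf_le_Limsup) simp
    then have "t > 0" using lower_q_dim_nonneg[OF q assms(2)] t(1) by (metis ereal_less(2) order.strict_trans1)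
    then have "d_plus n c \<mu> q \<le> ereal t"
      using False F_limsup_finite[OF q assms(2) _ t(1)] by (auto simp: d_plus_def intro!: Inf_lower)
    then show False using t(2) by simp
  qed
qed

end

theorem theorem2p2:
  fixes n :: "nat \<Rightarrow> nat"
    and S :: "nat \<Rightarrow> nat \<Rightarrow> real ^ 'd \<Rightarrow> real ^ 'd"
    and \<omega> :: "nat list \<Rightarrow> real ^ 'd"
    and J :: "(real ^ 'd) set"
    and Jf :: "nat list \<Rightarrow> (real ^ 'd) set"
    and E :: "(real ^ 'd) set"
    and \<mu> :: "(nat \<Rightarrow> nat) measure"
    and c :: "nat \<Rightarrow> nat \<Rightarrow> real"
    and q :: real
  assumes "nonautonomous_structure n S \<omega> J Jf"
    and "E = nonautonomous_attractor n Jf"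
    and "gap_separation_condition n Jf"
    and "finite_measure \<mu>" and "sets \<mu> = sets (word_borel n)" and "measure \<mu> (space \<mu>) > 0"
    and "\<And>k i x y. \<lbrakk>k \<ge> 1; i \<in> {1..n k}; x \<in> J; y \<in> J\<rbrakk>
           \<Longrightarrow> norm (S k i x - S k i y) \<ge> c k i * norm (x - y)"
    and "\<And>k i. \<lbrakk>k \<ge> 1; i \<in> {1..n k}\<rbrakk> \<Longrightarrow> c k i < 1"
    and "(INF k\<in>{1..}. INF i\<in>{1..n k}. ereal (c k i)) > 0"
    and "(SUP k\<in>{1..}. SUP i\<in>{1..n k}. ereal (c k i)) < 1"
    and "q > 0"
    and "q = 1 \<Longrightarrow> measure \<mu> (space \<mu>) \<ge> 1"
  shows "lower_q_dim q (image_measure \<mu> Jf) \<ge> d_minus n c \<mu> q \<and>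
         upper_q_dim q (image_measure \<mu> Jf) \<ge> d_plus n c \<mu> q"
proof -
  \<comment> \<open>A real strictly between the supremum and 1 serves as a uniform contraction bound
    for the geometric decay of ratios.\<close>
  obtain \<theta> where \<theta>: "(SUP k\<in>{1..}. SUP i\<in>{1..n k}. ereal (c k i)) < ereal \<theta>" "ereal \<theta> < 1"
    using ereal_dense2[OF assms(10)] by blast
  have c_pos: "c k i > 0" if "k \<ge> 1" "i \<in> {1..n k}" for k i
  proof -
    have "(INF k\<in>{1..}. INF i\<in>{1..n k}. ereal (c k i)) \<le> ereal (c k i)"
      using that by (intro INF_lower2[of k] INF_lower2[of i]) auto
    with assms(9) show ?thesis by (metis ereal_less(2) order.strict_trans2)
  qed
  have c_le: "c k i \<le> \<theta>" if "k \<ge> 1" "i \<in> {1..n k}" for k i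
  proof -
    have "ereal (c k i) \<le> (SUP k\<in>{1..}. SUP i\<in>{1..n k}. ereal (c k i))"
      using that by (intro SUP_upper2[of k] SUP_upper2[of i]) auto
    with \<theta>(1) have "ereal (c k i) < ereal \<theta>" by (rule le_less_trans[rotated])
    then show ?thesis by simp
  qed
  \<comment> \<open>Guarantees a letter at level 1, whose positive ratio forces
    \<open>\<theta>\<close> to be positive.\<close>
  have "n 1 \<ge> 2" using assms(1) by (simp add: nonautonomous_structure_def)
  then have "0 < \<theta>" using c_pos[of 1 1] c_le[of 1 1] by simp
  interpret finite_measure \<mu> by (rule assms(4))
  interpret gap_separated_system n c \<theta> \<mu> S \<omega> J Jf
    by unfold_locales (use assms(1,3,5,7) c_pos c_le \<open>0 < \<theta>\<close> \<theta>(2) in auto)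
  show ?thesis
    using d_minus_le_lower_q_dim d_plus_le_upper_q_dim assms(6,11,12) by blast
qed

end
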